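(* Let $H$ be a generalized Jacobi matrix associated with sequences $\{\varepsilon_jp_j\}_{j\ge 0}$, $\{b_j\}_{j\ge 0}$ such that there exists $N\in\mathbb{N}$ with $\deg p_j\le N$ for all $j\in\mathbb{Z}_+$ and $\sup\{b_j,|p^{(j)}_k|: j\in\mathbb{Z}_+,\ k=0,\dots,k_j-1\}<\infty$. Let $m(\lambda)=[(H-\lambda)^{-1}e,e]$ be the Weyl function of $H$. Then there exists a subsequence of the diagonal Padé approximants $f^{[n_j/n_j]}$ $(j=1,2,\dots)$ to $m$ which converges to $m$ locally uniformly in $\mathbb{C}\setminus\overline{\Theta(H)}$, where $\Theta(H)=\{(Hy,y)_{\ell^2}:\|y\|=1\}$ is the numerical range of $H$.
   Context: $\mathbb{Z}_+=\{0,1,2,\dots\}$; $\ell^2_{[0,\infty)}$ is the Hilbert space of complex square summable sequences $(w_0,w_1,\dots)$ with its usual inner product $(\cdot,\cdot)_{\ell^2}$ and norm $\|\cdot\|$. Data: for $j\in\mathbb{Z}_+$ let $p_j(\lambda)=\lambda^{k_j}+p^{(j)}_{k_j-1}\lambda^{k_j-1}+\dots+p^{(j)}_1\lambda+p^{(j)}_0$ be a real monic polynomial of degree $k_j\ge 1$, $\varepsilon_j\in\{1,-1\}$, $b_j>0$. Put $n_0=0$, $n_j=\sum_{i=0}^{j-1}k_i$ for $j\ge 1$. For a monic polynomial $p(\lambda)=\lambda^n+p_{n-1}\lambda^{n-1}+\dots+p_0$ (with $p_n=1$), the companion matrix $C_p$ is the $n\times n$ matrix with ones on the first subdiagonal,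 last column $(-p_0,-p_1,\dots,-p_{n-1})^\top$, and zeros elsewhere; $E_p$ is the $n\times n$ matrix with entries $(E_p)_{i,l}=p_{i+l+1}$, $0\le i,l\le n-1$, where $p_r=0$ for $r>n$. The generalized Jacobi matrix associated with $\{\varepsilon_jp_j\}$ and $\{b_j\}$ is the infinite tridiagonal block matrix $H$ with diagonal blocks $A_j=C_{p_j}$ ($k_j\times k_j$), subdiagonal blocks $B_j$ in block position $(j+1,j)$ ($k_{j+1}\times k_j$), and superdiagonal blocks $\widetilde B_j$ in block position $(j,j+1)$ ($k_j\times k_{j+1}$); the only nonzero entry of $B_j$ is its upper right corner entry, equal to $b_j$, and the only nonzero entry of $\widetilde B_j$ is its upper right corner entry, equal to $\varepsilon_j\varepsilon_{j+1}b_j$. Under the assumptions in the claim $H$ generates a bounded operator in $\ell^2_{[0,\infty)}$. $G=\mathrm{diag}(G_0,G_1,\dots)$ with $G_j=\varepsilon_jE_{p_j}^{-1}$ (a bounded, boundedly invertible self-adjoint operator in $\ell^2_{[0,\infty)}$), $[x,y]=(Gx,y)_{\ell^2}$, and $e=(1,0,0,\dots)^\top$. The Weyl function $m(\lambda)=[(H-\lambda)^{-1}e,e]$ is defined on the resolvent set $\rho(H)\supset\mathbb{C}\setminus\overline{\Theta(H)}$. The polynomials $P_j,Q_j$ are the solutions of $\varepsilon_{j-1}\varepsilon_jb_{j-1}u_{j-1}-p_j(\lambda)u_j+b_ju_{j+1}=0$ $(j\ge 1)$ with initial conditions $P_0=1$, $P_1=p_0(\lambda)/b_0$, $Q_0=0$,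 $Q_1=\varepsilon_0/b_0$. Padé approximants: the $[n/n]$ (the $n$-th diagonal) Padé approximant to $\varphi(\lambda)=-\sum_{j\ge0}s_j\lambda^{-j-1}$ is a ratio $f^{[n/n]}(\lambda)=A(1/\lambda)/B(1/\lambda)$ of polynomials $A,B$ of formal degree $n$ with $B(0)\neq0$ and $\sum_{j\ge 0}s_j\lambda^{-j-1}+f^{[n/n]}(\lambda)=O(\lambda^{-(2n+1)})$ as $\lambda\to\infty$. For $m$, the $[n_j/n_j]$ Padé approximant exists for all $j\ge 1$ and equals $f^{[n_j/n_j]}(\lambda)=-Q_j(\lambda)/P_j(\lambda)$. *)

theory Defs
  imports
    "HOL-Complex_Analysis.Complex_Analysis"
    "Jordan_Normal_Form.Gauss_Jordan_Elimination"
begin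

subsection \<open>The Hilbert space of square summable sequences\<close>

definition ell2 :: "(nat \<Rightarrow> complex) set" where
  "ell2 = {w. summable (\<lambda>i. (cmod (w i))\<^sup>2)}"

definition l2_inner :: "(nat \<Rightarrow> complex) \<Rightarrow> (nat \<Rightarrow> complex) \<Rightarrow> complex" where
  "l2_inner x y = (\<Sum>i. x i * cnj (y i))"

definition l2_norm :: "(nat \<Rightarrow> complex) \<Rightarrow> real" where
  "l2_norm x = sqrt (\<Sum>i. (cmod (x i))\<^sup>2)"

text \<open>The action of an infinite real matrix on a sequence. All matrices used below have finitely
  many nonzero entries in each row, so the series has only finitely many nonzero terms.\<close>

definition inf_mat_op :: "(nat \<Rightarrow> nat \<Rightarrow> real) \<Rightarrow> (nat \<Rightarrow> complex) \<Rightarrow> (nat \<Rightarrow> complex)" where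
  "inf_mat_op M x = (\<lambda>r. \<Sum>c. complex_of_real (M r c) * x c)"

definition numerical_range :: "((nat \<Rightarrow> complex) \<Rightarrow> (nat \<Rightarrow> complex)) \<Rightarrow> complex set" where
  "numerical_range T = {l2_inner (T y) y | y. y \<in> ell2 \<and> l2_norm y = 1}"

text \<open>This is the resolvent operator \<open>(T - z)\<^sup>-\<^sup>1\<close> when \<open>T - z\<close> is a bijection of \<open>ell2\<close>, in particular
  for \<open>z\<close> in the resolvent set; for other \<open>z\<close> its values carry no meaning.\<close>

definition resolvent ::
  "((nat \<Rightarrow> complex) \<Rightarrow> (nat \<Rightarrow> complex)) \<Rightarrow> complex \<Rightarrow> (nat \<Rightarrow> complex) \<Rightarrow> (nat \<Rightarrow> complex)" where
  "resolvent T z = inv_into ell2 (\<lambda>x i. T x i - z * x i)"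


subsection \<open>Generalized Jacobi matrices\<close>

definition companion_matrix :: "real poly \<Rightarrow> real mat" where
  "companion_matrix q = Matrix.mat (degree q) (degree q)
     (\<lambda>(r, c). if c = degree q - 1 then - poly.coeff q r else if r = c + 1 then 1 else 0)"

definition E_matrix :: "real poly \<Rightarrow> real mat" where
  "E_matrix q = Matrix.mat (degree q) (degree q) (\<lambda>(i, l). poly.coeff q (i + l + 1))"

definition upper_right_corner_mat :: "nat \<Rightarrow> nat \<Rightarrow> real \<Rightarrow> real mat" where
  "upper_right_corner_mat nr nc a =
     Matrix.mat nr nc (\<lambda>(r, c). if r = 0 \<and> c = nc - 1 then a else 0)"

text \<open>For block sizes \<open>k\<^sub>0, k\<^sub>1, \<dots>\<close>, block number \<open>j\<close> occupies the indices \<open>n\<^sub>j, \<dots>, n\<^sub>j\<^sub>+\<^sub>1 - 1\<close> where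
  \<open>n\<^sub>j = block_start k j\<close>.\<close>

definition block_start :: "(nat \<Rightarrow> nat) \<Rightarrow> nat \<Rightarrow> nat" where
  "block_start k j = (\<Sum>i<j. k i)"

definition block_index :: "(nat \<Rightarrow> nat) \<Rightarrow> nat \<Rightarrow> nat" where
  "block_index k r = (LEAST j. r < block_start k (Suc j))"

definition block_matrix :: "(nat \<Rightarrow> nat) \<Rightarrow> (nat \<Rightarrow> nat \<Rightarrow> real mat) \<Rightarrow> nat \<Rightarrow> nat \<Rightarrow> real" where
  "block_matrix k M r c =
     (let i = block_index k r; j = block_index k c
      in M i j $$ (r - block_start k i, c - block_start k j))"

definition jacobi_block ::
  "(nat \<Rightarrow> real) \<Rightarrow> (nat \<Rightarrow> real poly) \<Rightarrow> (nat \<Rightarrow> real) \<Rightarrow> nat \<Rightarrow> nat \<Rightarrow> real mat" where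
  "jacobi_block \<epsilon> p b i j =
     (if i = j then companion_matrix (p j)
      else if i = Suc j then
        upper_right_corner_mat (degree (p i)) (degree (p j)) (b j)
      else if j = Suc i then
        upper_right_corner_mat (degree (p i)) (degree (p j)) (\<epsilon> i * \<epsilon> j * b i)
      else 0\<^sub>m (degree (p i)) (degree (p j)))"

definition gen_jacobi_matrix ::
  "(nat \<Rightarrow> real) \<Rightarrow> (nat \<Rightarrow> real poly) \<Rightarrow> (nat \<Rightarrow> real) \<Rightarrow> nat \<Rightarrow> nat \<Rightarrow> real" where
  "gen_jacobi_matrix \<epsilon> p b = block_matrix (\<lambda>j. degree (p j)) (jacobi_block \<epsilon> p b)"

text \<open>For monic \<open>q\<close> the Hankel matrix \<open>E_matrix q\<close> has ones on the antidiagonal and zeros below it,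
  so \<open>mat_inverse\<close> does return its inverse.\<close>

definition gram_block :: "(nat \<Rightarrow> real) \<Rightarrow> (nat \<Rightarrow> real poly) \<Rightarrow> nat \<Rightarrow> nat \<Rightarrow> real mat" where
  "gram_block \<epsilon> p i j =
     (if i = j then \<epsilon> j \<cdot>\<^sub>m the (mat_inverse (E_matrix (p j)))
      else 0\<^sub>m (degree (p i)) (degree (p j)))"

definition gram_matrix :: "(nat \<Rightarrow> real) \<Rightarrow> (nat \<Rightarrow> real poly) \<Rightarrow> nat \<Rightarrow> nat \<Rightarrow> real" where
  "gram_matrix \<epsilon> p = block_matrix (\<lambda>j. degree (p j)) (gram_block \<epsilon> p)"

definition indef_inner ::
  "(nat \<Rightarrow> real) \<Rightarrow> (nat \<Rightarrow> real poly) \<Rightarrow> (nat \<Rightarrow> complex) \<Rightarrow> (nat \<Rightarrow> complex) \<Rightarrow> complex" where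
  "indef_inner \<epsilon> p x y = l2_inner (inf_mat_op (gram_matrix \<epsilon> p) x) y"

definition e_vec :: "nat \<Rightarrow> complex" where
  "e_vec = (\<lambda>i. if i = 0 then 1 else 0)"

abbreviation gen_jacobi_op ::
  "(nat \<Rightarrow> real) \<Rightarrow> (nat \<Rightarrow> real poly) \<Rightarrow> (nat \<Rightarrow> real) \<Rightarrow> (nat \<Rightarrow> complex) \<Rightarrow> (nat \<Rightarrow> complex)" where
  "gen_jacobi_op \<epsilon> p b \<equiv> inf_mat_op (gen_jacobi_matrix \<epsilon> p b)"

definition weyl_function ::
  "(nat \<Rightarrow> real) \<Rightarrow> (nat \<Rightarrow> real poly) \<Rightarrow> (nat \<Rightarrow> real) \<Rightarrow> complex \<Rightarrow> complex" where
  "weyl_function \<epsilon> p b z = indef_inner \<epsilon> p (resolvent (gen_jacobi_op \<epsilon> p b) z e_vec) e_vec"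


subsection \<open>Diagonal Pade approximants at infinity\<close>

text \<open>The rational function \<open>A(1/z)/B(1/z)\<close> is turned into a total function by \<open>remove_sings\<close>: at
  every point (\<open>0\<close> included) where it has a finite limit it takes that limit as its value, and its
  value is \<open>0\<close> at its poles. Equal rational functions are thus equal as functions. The
  approximated function \<open>\<phi>\<close> takes the place of its expansion \<open>- (\<Sum>j. s\<^sub>j / z\<^sup>j\<^sup>+\<^sup>1)\<close>
  in the order condition.\<close>

definition is_diag_pade ::
  "(complex \<Rightarrow> complex) \<Rightarrow> nat \<Rightarrow> (complex \<Rightarrow> complex) \<Rightarrow> bool" where
  "is_diag_pade \<phi> n f \<longleftrightarrow>
     (\<exists>A B :: complex poly. degree A \<le> n \<and> degree B \<le> n \<and> poly B 0 \<noteq> 0 \<and>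
        f = remove_sings (\<lambda>z. poly A (1 / z) / poly B (1 / z)) \<and>
        (\<lambda>z. f z - \<phi> z) \<in> O[at_infinity](\<lambda>z. 1 / z ^ (2 * n + 1)))"

definition diag_pade :: "(complex \<Rightarrow> complex) \<Rightarrow> nat \<Rightarrow> complex \<Rightarrow> complex" where
  "diag_pade \<phi> n = (THE f. is_diag_pade \<phi> n f)"


subsection \<open>Locally uniform convergence\<close>

text \<open>If the \<open>f l\<close> are rational functions extended by \<open>0\<close> to their poles, \<open>g\<close> is continuous and \<open>U\<close>
  is open, then this forces every point of \<open>U\<close> to have a neighbourhood that contains no pole of
  \<open>f l\<close> for large \<open>l\<close>, because \<open>f l\<close> is unbounded near each of its poles.\<close>

definition locally_uniform_limit ::
  "complex set \<Rightarrow> (nat \<Rightarrow> complex \<Rightarrow> complex) \<Rightarrow> (complex \<Rightarrow> complex) \<Rightarrow> bool" where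
  "locally_uniform_limit U f g \<longleftrightarrow>
     (\<forall>z\<in>U. \<exists>r>0. uniform_limit (ball z r \<inter> U) f g sequentially)"

end

theory Submission
  imports Defs "Jordan_Normal_Form.Determinant"
begin

text \<open>Off the closure of the numerical range, \<open>|((H - z) y, y)| \<ge> \<delta> \<parallel>y\<parallel>\<^sup>2\<close>, and finite sections of \<open>H\<close> inherit this
  bound. Hence the sections are invertible with uniformly bounded solutions of \<open>(H - z) x = e\<close>, and a
  coordinatewise limit of these solves the infinite system. The last coordinates \<open>t\<^sub>j\<close> of the blocks of
  a solution satisfy the three-term recurrence, with \<open>m = \<epsilon>\<^sub>0 t\<^sub>0\<close>; the section of size \<open>n\<^sub>j\<close> gives
  \<open>- Q\<^sub>j / P\<^sub>j\<close> in the same way, from some \<open>\<tau>\<close>. The Wronskian of the two solutions is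
  \<open>- Q\<^sub>j / P\<^sub>j - m = \<epsilon>\<^sub>j b\<^sub>j\<^sub>-\<^sub>1 \<tau>\<^sub>j\<^sub>-\<^sub>1 t\<^sub>j\<close>. This identity gives convergence, since \<open>\<tau>\<close> is bounded and
  \<open>t\<^sub>j \<rightarrow> 0\<close>, locally uniformly by equicontinuity in \<open>z\<close>; it also gives the order of contact at infinity,
  since there \<open>\<tau>\<^sub>j\<^sub>-\<^sub>1 = O(z\<^bsup>-n\<^esup>)\<close> and \<open>t\<^sub>j = O(z\<^bsup>-n-1\<^esup>)\<close> with \<open>n = n\<^sub>j\<close>. In particular the whole sequence
  converges.\<close>

subsection \<open>Square summable sequences\<close>

lemma ell2_summable: "x \<in> ell2 \<Longrightarrow> summable (\<lambda>i. (cmod (x i))\<^sup>2)"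
  by (simp add: ell2_def)

lemma l2_norm_nonneg [simp]: "x \<in> ell2 \<Longrightarrow> 0 \<le> l2_norm x"
  by (simp add: l2_norm_def suminf_nonneg ell2_summable)

lemma l2_norm_sq: "x \<in> ell2 \<Longrightarrow> (l2_norm x)\<^sup>2 = (\<Sum>i. (cmod (x i))\<^sup>2)"
  by (simp add: l2_norm_def suminf_nonneg ell2_summable)

lemma sum_le_l2_norm_sq: "x \<in> ell2 \<Longrightarrow> (\<Sum>i<n. (cmod (x i))\<^sup>2) \<le> (l2_norm x)\<^sup>2"
  by (simp add: l2_norm_sq sum_le_suminf ell2_summable)

lemma cmod_le_l2_norm: 
  assumes "x \<in> ell2" shows "cmod (x i) \<le> l2_norm x"
proof -
  have "(cmod (x i))\<^sup>2 \<le> (\<Sum>i<Suc i. (cmod (x i))\<^sup>2)" by (simp add: sum_nonneg)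
  also have "\<dots> \<le> (l2_norm x)\<^sup>2" by (rule sum_le_l2_norm_sq[OF assms])
  finally show ?thesis by (rule power2_le_imp_le) (simp add: assms)
qed

lemma ell2_tendsto_0:
  assumes "x \<in> ell2" shows "x \<longlonglongrightarrow> 0"
proof -
  have "(\<lambda>i. sqrt ((cmod (x i))\<^sup>2)) \<longlonglongrightarrow> sqrt 0"
    by (intro tendsto_real_sqrt summable_LIMSEQ_zero ell2_summable assms)
  then show ?thesis by (simp add: tendsto_norm_zero_iff)
qed

lemma ell2_bounded_sums:
  assumes "\<And>n. (\<Sum>i<n. (cmod (x i))\<^sup>2) \<le> C\<^sup>2" and "C \<ge> 0"
  shows "x \<in> ell2" and "l2_norm x \<le> C"
proof -
  have s: "summable (\<lambda>i. (cmod (x i))\<^sup>2)"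
    by (rule summableI_nonneg_bounded[where x="C\<^sup>2"]) (use assms in auto)
  then show "x \<in> ell2" by (simp add: ell2_def)
  have "(\<Sum>i. (cmod (x i))\<^sup>2) \<le> C\<^sup>2" by (rule suminf_le_const[OF s assms(1)])
  then show "l2_norm x \<le> C"
    unfolding l2_norm_def using assms(2) by (metis real_sqrt_le_mono real_sqrt_abs abs_of_nonneg)
qed

lemma ell2_finite_support:
  assumes "\<And>i. i \<ge> n \<Longrightarrow> x i = 0" shows "x \<in> ell2"
  unfolding ell2_def mem_Collect_eq
  by (rule summable_finite[of "{..<n}"]) (simp_all add: assms not_less)

lemma ell2_cmult:
  assumes "x \<in> ell2"
  shows "(\<lambda>i. c * x i) \<in> ell2" and "l2_norm (\<lambda>i. c * x i) = cmod c * l2_norm x"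
proof -
  have sq: "(cmod (c * x i))\<^sup>2 = (cmod c)\<^sup>2 * (cmod (x i))\<^sup>2" for i
    by (simp add: norm_mult power_mult_distrib)
  show "(\<lambda>i. c * x i) \<in> ell2"
    unfolding ell2_def mem_Collect_eq sq by (intro summable_mult ell2_summable assms)
  show "l2_norm (\<lambda>i. c * x i) = cmod c * l2_norm x"
    unfolding l2_norm_def sq suminf_mult[OF ell2_summable[OF assms]] by (simp add: real_sqrt_mult)
qed

lemma ell2_diff:
  assumes "x \<in> ell2" "y \<in> ell2" shows "(\<lambda>i. x i - y i) \<in> ell2"
proof -
  have "(cmod (x i - y i))\<^sup>2 \<le> 2 * (cmod (x i))\<^sup>2 + 2 * (cmod (y i))\<^sup>2" for i
  proof -
    have "(cmod (x i - y i))\<^sup>2 \<le> (cmod (x i) + cmod (y i))\<^sup>2"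
      by (intro power_mono norm_triangle_ineq4) auto
    also have "\<dots> \<le> 2 * (cmod (x i))\<^sup>2 + 2 * (cmod (y i))\<^sup>2"
      using sum_squares_bound[of "cmod (x i)" "cmod (y i)"] by (simp add: power2_sum)
    finally show ?thesis .
  qed
  moreover have "summable (\<lambda>i. 2 * (cmod (x i))\<^sup>2 + 2 * (cmod (y i))\<^sup>2)"
    by (intro summable_add summable_mult ell2_summable assms)
  ultimately show ?thesis
    unfolding ell2_def mem_Collect_eq by (elim summable_comparison_test'[where N=0]) simp
qed

lemma ell2_inner_summable_norm:
  assumes "x \<in> ell2" "y \<in> ell2"
  shows "summable (\<lambda>i. cmod (x i * cnj (y i)))"
    and "(\<Sum>i. cmod (x i * cnj (y i))) \<le> l2_norm x * l2_norm y"
proof -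
  have *: "(\<Sum>i<n. cmod (x i * cnj (y i))) \<le> l2_norm x * l2_norm y" for n
  proof -
    have "(\<Sum>i<n. cmod (x i * cnj (y i)))
        \<le> L2_set (\<lambda>i. cmod (x i)) {..<n} * L2_set (\<lambda>i. cmod (y i)) {..<n}"
      using L2_set_mult_ineq[of "\<lambda>i. cmod (x i)" "\<lambda>i. cmod (y i)" "{..<n}"]
      by (simp add: norm_mult)
    also have "\<dots> \<le> l2_norm x * l2_norm y"
    proof (rule mult_mono)
      show "L2_set (\<lambda>i. cmod (x i)) {..<n} \<le> l2_norm x"
        unfolding L2_set_def using sum_le_l2_norm_sq[OF assms(1)] assms by (intro real_le_lsqrt) auto
      show "L2_set (\<lambda>i. cmod (y i)) {..<n} \<le> l2_norm y"
        unfolding L2_set_def using sum_le_l2_norm_sq[OF assms(2)] assms by (intro real_le_lsqrt) auto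
    qed (use assms in \<open>auto simp: L2_set_nonneg\<close>)
    finally show ?thesis .
  qed
  show s: "summable (\<lambda>i. cmod (x i * cnj (y i)))"
    by (rule summableI_nonneg_bounded[OF _ *]) simp
  show "(\<Sum>i. cmod (x i * cnj (y i))) \<le> l2_norm x * l2_norm y"
    by (rule suminf_le_const[OF s *])
qed

lemma ell2_inner_summable: "x \<in> ell2 \<Longrightarrow> y \<in> ell2 \<Longrightarrow> summable (\<lambda>i. x i * cnj (y i))"
  by (rule summable_norm_cancel) (rule ell2_inner_summable_norm)

lemma l2_Cauchy_Schwarz:
  assumes "x \<in> ell2" "y \<in> ell2"
  shows "cmod (l2_inner x y) \<le> l2_norm x * l2_norm y"
  unfolding l2_inner_def
  using summable_norm[OF ell2_inner_summable_norm(1)[OF assms]] ell2_inner_summable_norm(2)[OF assms]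
  by linarith

lemma l2_inner_self:
  assumes "x \<in> ell2" shows "l2_inner x x = complex_of_real ((l2_norm x)\<^sup>2)"
proof -
  have "l2_inner x x = (\<Sum>i. complex_of_real ((cmod (x i))\<^sup>2))"
    by (simp only: l2_inner_def complex_norm_square)
  also have "\<dots> = complex_of_real ((l2_norm x)\<^sup>2)"
    by (simp only: l2_norm_sq[OF assms] suminf_of_real[OF ell2_summable[OF assms]])
  finally show ?thesis .
qed

lemma l2_inner_diff_left:
  assumes "x \<in> ell2" "y \<in> ell2" "w \<in> ell2"
  shows "l2_inner (\<lambda>i. x i - y i) w = l2_inner x w - l2_inner y w"
  by (simp add: l2_inner_def left_diff_distrib ell2_inner_summable assms suminf_diff)

lemma l2_inner_cmult_left:
  assumes "x \<in> ell2" "w \<in> ell2"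
  shows "l2_inner (\<lambda>i. c * x i) w = c * l2_inner x w"
  by (simp add: l2_inner_def mult.assoc ell2_inner_summable assms suminf_mult)

lemma l2_inner_single:
  assumes "\<And>i. i \<noteq> 0 \<Longrightarrow> x i * cnj (y i) = 0"
  shows "l2_inner x y = x 0 * cnj (y 0)"
  unfolding l2_inner_def by (subst suminf_finite[of "{0}"]) (use assms in auto)

text \<open>The truncated subtraction below duplicates the coordinate \<open>0\<close>, which only enlarges the
  bound.\<close>

lemma ell2_shift:
  assumes "x \<in> ell2"
  shows "summable (\<lambda>i. (cmod (x (i + d - w)))\<^sup>2)"
    and "(\<Sum>i. (cmod (x (i + d - w)))\<^sup>2) \<le> (real w + 1) * (l2_norm x)\<^sup>2"
proof -
  have *: "(\<Sum>i<n. (cmod (x (i + d - w)))\<^sup>2) \<le> (real w + 1) * (l2_norm x)\<^sup>2" for n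
  proof -
    have "(\<Sum>i<n. (cmod (x (i + d - w)))\<^sup>2)
        \<le> (\<Sum>i<w. (cmod (x (i + d - w)))\<^sup>2) + (\<Sum>i\<in>{w..<w+n}. (cmod (x (i + d - w)))\<^sup>2)"
      by (subst sum.union_disjoint[symmetric]) (auto intro!: sum_mono2)
    also have "(\<Sum>i<w. (cmod (x (i + d - w)))\<^sup>2) \<le> (\<Sum>i<w. (l2_norm x)\<^sup>2)"
      by (intro sum_mono power_mono cmod_le_l2_norm assms) auto
    also have "(\<Sum>i\<in>{w..<w+n}. (cmod (x (i + d - w)))\<^sup>2) = (\<Sum>i\<in>{d..<d+n}. (cmod (x i))\<^sup>2)"
      by (rule sum.reindex_bij_witness[of _ "\<lambda>i. i + w - d" "\<lambda>i. i + d - w"]) auto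
    also have "\<dots> \<le> (\<Sum>i<d+n. (cmod (x i))\<^sup>2)"
      by (rule sum_mono2) auto
    also have "\<dots> \<le> (l2_norm x)\<^sup>2" by (rule sum_le_l2_norm_sq[OF assms])
    finally show ?thesis by (simp add: algebra_simps)
  qed
  show s: "summable (\<lambda>i. (cmod (x (i + d - w)))\<^sup>2)"
    by (rule summableI_nonneg_bounded[OF _ *]) simp
  show "(\<Sum>i. (cmod (x (i + d - w)))\<^sup>2) \<le> (real w + 1) * (l2_norm x)\<^sup>2"
    by (rule suminf_le_const[OF s *])
qed

text \<open>Cauchy-Schwarz over the \<open>2 * w + 1\<close> positions of the band gives one factor
  \<open>2 * w + 1\<close>, summing over the shifts gives a second one, and
  \<open>ell2_shift\<close> bounds each shifted copy of \<open>x\<close>.\<close>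

lemma band_operator_bounded:
  assumes "x \<in> ell2" "K \<ge> 0"
    and band: "\<And>i. cmod (y i) \<le> K * (\<Sum>d\<le>2*w. cmod (x (i + d - w)))"
  shows "y \<in> ell2" and "l2_norm y \<le> K * (2 * real w + 1) * (real w + 1) * l2_norm x"
proof -
  let ?C = "K * (2 * real w + 1) * (real w + 1) * l2_norm x"
  have shift: "(\<Sum>i<n. (cmod (x (i + d - w)))\<^sup>2) \<le> (real w + 1) * (l2_norm x)\<^sup>2" for n d
    using sum_le_suminf[OF ell2_shift(1)[OF assms(1), of d w], of "{..<n}"] ell2_shift(2)[OF assms(1), of d w]
    by simp
  have "(\<Sum>i<n. (cmod (y i))\<^sup>2) \<le> ?C\<^sup>2" for n
  proof -
    have "(cmod (y i))\<^sup>2 \<le> K\<^sup>2 * ((2 * real w + 1) * (\<Sum>d\<le>2*w. (cmod (x (i + d - w)))\<^sup>2))" for i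
    proof -
      have "(cmod (y i))\<^sup>2 \<le> (K * (\<Sum>d\<le>2*w. cmod (x (i + d - w))))\<^sup>2"
        by (rule power_mono[OF band]) simp
      also have "\<dots> = K\<^sup>2 * (\<Sum>d\<le>2*w. cmod (x (i + d - w)))\<^sup>2"
        by (simp add: power_mult_distrib)
      also have "(\<Sum>d\<le>2*w. cmod (x (i + d - w)))\<^sup>2
          \<le> (2 * real w + 1) * (\<Sum>d\<le>2*w. (cmod (x (i + d - w)))\<^sup>2)"
        using Cauchy_Schwarz_ineq_sum[of "\<lambda>d. 1" "\<lambda>d. cmod (x (i + d - w))" "{..2*w}"]
        by (simp add: algebra_simps)
      finally show ?thesis by (simp add: mult_left_mono)
    qed
    then have "(\<Sum>i<n. (cmod (y i))\<^sup>2)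
        \<le> (\<Sum>i<n. K\<^sup>2 * ((2 * real w + 1) * (\<Sum>d\<le>2*w. (cmod (x (i + d - w)))\<^sup>2)))"
      by (rule sum_mono)
    also have "\<dots> = K\<^sup>2 * ((2 * real w + 1) * (\<Sum>i<n. \<Sum>d\<le>2*w. (cmod (x (i + d - w)))\<^sup>2))"
      by (simp only: sum_distrib_left)
    also have "\<dots> = K\<^sup>2 * ((2 * real w + 1) * (\<Sum>d\<le>2*w. \<Sum>i<n. (cmod (x (i + d - w)))\<^sup>2))"
      by (subst sum.swap) (rule refl)
    also have "\<dots> \<le> K\<^sup>2 * ((2 * real w + 1) * (\<Sum>d\<le>2*w. (real w + 1) * (l2_norm x)\<^sup>2))"
      by (intro mult_left_mono sum_mono shift) auto
    also have "\<dots> = K\<^sup>2 * (2 * real w + 1)\<^sup>2 * (l2_norm x)\<^sup>2 * (real w + 1)"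
      by (simp add: power2_eq_square mult_ac)
    \<comment> \<open>Squaring the factor \<open>w + 1\<close> makes the bound a perfect square, so
      no root enters the constant.\<close>
    also have "\<dots> \<le> K\<^sup>2 * (2 * real w + 1)\<^sup>2 * (l2_norm x)\<^sup>2 * (real w + 1)\<^sup>2"
      by (intro mult_left_mono) (auto simp: power2_eq_square)
    also have "\<dots> = ?C\<^sup>2" by (simp add: power_mult_distrib)
    finally show ?thesis .
  qed
  moreover have "?C \<ge> 0" using assms(1,2) by simp
  ultimately show "y \<in> ell2" and "l2_norm y \<le> ?C"
    using ell2_bounded_sums[of y ?C] by simp_all
qed

text \<open>Both sides are homogeneous of degree two in \<open>y\<close>, and for norm one the
  inequality is the assumed gap itself. The vector \<open>u\<close> is \<open>y\<close>
  normalized.\<close>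

lemma numerical_range_coercive:
  assumes T: "\<And>y. y \<in> ell2 \<Longrightarrow> T y \<in> ell2"
    and homogeneous: "\<And>c y. T (\<lambda>i. c * y i) = (\<lambda>i. c * T y i)"
    and gap: "\<And>w. w \<in> numerical_range T \<Longrightarrow> \<delta> \<le> dist w z"
    and y: "y \<in> ell2"
  shows "\<delta> * (l2_norm y)\<^sup>2 \<le> cmod (l2_inner (\<lambda>i. T y i - z * y i) y)"
proof (cases "l2_norm y = 0")
  case False
  define c where "c = complex_of_real (1 / l2_norm y)"
  define u where "u = (\<lambda>i. c * y i)"
  have pos: "l2_norm y > 0" using False y by (simp add: less_le)
  have u: "u \<in> ell2" "l2_norm u = 1"
    using ell2_cmult[OF y, of c] pos by (auto simp: u_def c_def norm_divide)
  have "l2_inner (T u) u = (\<Sum>i. (c * cnj c) * (T y i * cnj (y i)))"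
    by (simp add: l2_inner_def u_def homogeneous mult_ac)
  also have "\<dots> = (c * cnj c) * l2_inner (T y) y"
    unfolding l2_inner_def by (rule suminf_mult[OF ell2_inner_summable[OF T[OF y] y]])
  finally have eq: "l2_inner (T u) u = l2_inner (T y) y / complex_of_real ((l2_norm y)\<^sup>2)"
    by (simp add: c_def power2_eq_square)
  have "\<delta> \<le> dist (l2_inner (T u) u) z"
    by (rule gap) (use u in \<open>auto simp: numerical_range_def\<close>)
  then have "\<delta> \<le> cmod (l2_inner (T y) y / complex_of_real ((l2_norm y)\<^sup>2) - z)"
    by (simp add: eq dist_norm)
  also have "\<dots> = cmod ((l2_inner (T y) y - z * complex_of_real ((l2_norm y)\<^sup>2))
      / complex_of_real ((l2_norm y)\<^sup>2))"
    using False by (simp add: field_simps)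
  also have "\<dots> = cmod (l2_inner (T y) y - z * complex_of_real ((l2_norm y)\<^sup>2)) / (l2_norm y)\<^sup>2"
    by (subst norm_divide) (simp add: norm_power)
  finally have "\<delta> * (l2_norm y)\<^sup>2 \<le> cmod (l2_inner (T y) y - z * complex_of_real ((l2_norm y)\<^sup>2))"
    using pos by (simp add: field_simps)
  then show ?thesis
    using y T[OF y] ell2_cmult(1)[OF y, of z]
    by (simp add: l2_inner_diff_left l2_inner_cmult_left l2_inner_self)
qed simp

subsection \<open>Uniqueness of diagonal Pade approximants\<close>

text \<open>Letting \<open>w\<close> tend to \<open>0\<close> kills the constant coefficient;
  dividing by \<open>w\<close> then lowers the degree and the order of vanishing together.\<close>

lemma poly_eq_0_if_vanishing_order:
  fixes D :: "complex poly"
  assumes "degree D \<le> m" "eventually (\<lambda>w. norm (poly D w) \<le> C * norm w ^ Suc m) (at 0)"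
  shows "D = 0"
  using assms
proof (induction m arbitrary: D)
  case (0 D)
  then obtain a where D: "D = [:a:]" by (metis degree_eq_zeroE le_zero_eq)
  have "((\<lambda>w::complex. norm (poly D w)) \<longlongrightarrow> norm a) (at 0)"
    unfolding D by simp
  moreover have "((\<lambda>w::complex. C * norm w ^ Suc 0) \<longlongrightarrow> C * norm (0::complex) ^ Suc 0) (at 0)"
    by (intro tendsto_intros)
  ultimately have "norm a \<le> C * norm (0::complex) ^ Suc 0"
    using 0(2) by (intro tendsto_le[rotated 1]) auto
  then show ?case using D by simp
next
  case (Suc m D)
  obtain a D' where D: "D = pCons a D'" by (cases D)
  have "((\<lambda>w::complex. norm (poly D w)) \<longlongrightarrow> norm (poly D 0)) (at 0)"
    by (intro tendsto_intros)
  moreover have "((\<lambda>w::complex. C * norm w ^ Suc (Suc m)) \<longlongrightarrow> C * norm (0::complex) ^ Suc (Suc m)) (at 0)"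
    by (intro tendsto_intros)
  ultimately have "norm (poly D 0) \<le> C * norm (0::complex) ^ Suc (Suc m)"
    using Suc(3) by (intro tendsto_le[rotated 1]) auto
  then have a: "a = 0" by (simp add: D)
  have "eventually (\<lambda>w::complex. w \<noteq> 0) (at 0)" by (simp add: eventually_at_filter)
  with Suc(3) have "eventually (\<lambda>w. norm (poly D' w) \<le> C * norm w ^ Suc m) (at 0)"
  proof eventually_elim
    case (elim w)
    then have "norm w * norm (poly D' w) \<le> norm w * (C * norm w ^ Suc m)"
      by (simp add: D a norm_mult mult_ac)
    then show ?case using elim by simp
  qed
  moreover have "degree D' \<le> m" using Suc(2) by (cases "D' = 0") (auto simp: D)
  ultimately have "D' = 0" using Suc(1) by blast
  then show ?case by (simp add: D a)
qed

lemma remove_sings_pade_eq: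
  assumes "z \<noteq> 0" "poly B (1 / z) \<noteq> (0::complex)"
  shows "remove_sings (\<lambda>z. poly A (1 / z) / poly B (1 / z)) z = poly A (1 / z) / poly B (1 / z)"
  by (rule remove_sings_eqI) (use assms in \<open>auto intro!: tendsto_intros\<close>)

lemma eventually_poly_inverse_neq_0:
  assumes "poly B 0 \<noteq> (0::complex)"
  shows "eventually (\<lambda>z. poly B (1 / z) \<noteq> 0) at_infinity"
proof -
  have "((\<lambda>z. poly B (1 / z)) \<longlongrightarrow> poly B 0) at_infinity"
    by (intro tendsto_poly) (simp add: divide_inverse tendsto_inverse_0)
  then show ?thesis using assms by (rule tendsto_imp_eventually_ne)
qed

text \<open>In the variable \<open>w = 1 / z\<close> the polynomial \<open>D\<close> has degree at
  most \<open>2 * n\<close> but is \<open>O(w^(2n+1))\<close> at \<open>0\<close>, hence is zero.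
  Equality as functions, poles included, then comes from \<open>remove_sings\<close>, which looks
  only at punctured neighbourhoods.\<close>

lemma is_diag_pade_unique:
  assumes "is_diag_pade \<phi> n f" "is_diag_pade \<phi> n g"
  shows "f = g"
proof -
  obtain A B where AB: "degree A \<le> n" "degree B \<le> n" "poly B 0 \<noteq> 0"
      "f = remove_sings (\<lambda>z. poly A (1 / z) / poly B (1 / z))"
      "(\<lambda>z. f z - \<phi> z) \<in> O[at_infinity](\<lambda>z. 1 / z ^ (2 * n + 1))"
    using assms(1) by (auto simp: is_diag_pade_def)
  obtain A' B' where AB': "degree A' \<le> n" "degree B' \<le> n" "poly B' 0 \<noteq> 0"
      "g = remove_sings (\<lambda>z. poly A' (1 / z) / poly B' (1 / z))"
      "(\<lambda>z. g z - \<phi> z) \<in> O[at_infinity](\<lambda>z. 1 / z ^ (2 * n + 1))"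
    using assms(2) by (auto simp: is_diag_pade_def)
  define D where "D = A * B' - A' * B"
  have "(\<lambda>z. (f z - \<phi> z) - (g z - \<phi> z)) \<in> O[at_infinity](\<lambda>z. 1 / z ^ (2 * n + 1))"
    by (rule sum_in_bigo(2)[OF AB(5) AB'(5)])
  moreover have "((\<lambda>z. poly B (1 / z) * poly B' (1 / z)) \<longlongrightarrow> poly B 0 * poly B' 0) at_infinity"
    by (intro tendsto_intros tendsto_poly) (simp_all add: divide_inverse tendsto_inverse_0)
  then have "(\<lambda>z. poly B (1 / z) * poly B' (1 / z)) \<in> O[at_infinity](\<lambda>_. 1)"
    by (intro bigoI_tendsto[where c="poly B 0 * poly B' 0"]) auto
  ultimately have "(\<lambda>z. ((f z - \<phi> z) - (g z - \<phi> z)) * (poly B (1 / z) * poly B' (1 / z)))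
      \<in> O[at_infinity](\<lambda>z. 1 / z ^ (2 * n + 1) * 1)"
    by (rule landau_o.big.mult)
  then obtain C where "eventually (\<lambda>z. norm ((f z - g z) * (poly B (1 / z) * poly B' (1 / z)))
      \<le> C * norm (1 / z ^ (2 * n + 1))) at_infinity"
    by (auto elim!: landau_o.bigE)
  moreover have "eventually (\<lambda>z::complex. z \<noteq> 0) at_infinity"
    by (rule eventually_not_equal_at_infinity)
  moreover note eventually_poly_inverse_neq_0[OF AB(3)] eventually_poly_inverse_neq_0[OF AB'(3)]
  ultimately have "eventually (\<lambda>z. norm (poly D (1 / z)) \<le> C * norm (1 / z) ^ Suc (2 * n)) at_infinity"
  proof eventually_elim
    case (elim z)
    then have "f z = poly A (1 / z) / poly B (1 / z)" "g z = poly A' (1 / z) / poly B' (1 / z)"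
      unfolding AB(4) AB'(4) by (simp_all add: remove_sings_pade_eq)
    then have fB: "f z * poly B (1 / z) = poly A (1 / z)" "g z * poly B' (1 / z) = poly A' (1 / z)"
      using elim by simp_all
    have "(f z - g z) * (poly B (1 / z) * poly B' (1 / z))
        = (f z * poly B (1 / z)) * poly B' (1 / z) - (g z * poly B' (1 / z)) * poly B (1 / z)"
      by (simp add: algebra_simps)
    then have "(f z - g z) * (poly B (1 / z) * poly B' (1 / z)) = poly D (1 / z)"
      by (simp add: D_def fB)
    with elim show ?case by (simp add: norm_divide norm_power norm_mult power_one_over)
  qed
  then have "eventually (\<lambda>z. norm (poly D z) \<le> C * norm z ^ Suc (2 * n)) (at 0)"
    by (simp add: at_to_infinity eventually_filtermap divide_inverse)
  moreover have "degree D \<le> 2 * n"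
    unfolding D_def using degree_mult_le[of A B'] degree_mult_le[of A' B] AB AB'
    by (intro degree_diff_le) linarith+
  ultimately have "D = 0" by (rule poly_eq_0_if_vanishing_order[rotated])
  then have eq: "A * B' = A' * B" by (simp add: D_def)
  have ev: "eventually (\<lambda>z. poly P (1 / z) \<noteq> 0) (at w)"
    if "poly P 0 \<noteq> 0" for P :: "complex poly" and w
  proof -
    have "finite {z. poly P z = 0}" using that by (intro poly_roots_finite) auto
    \<comment> \<open>The point \<open>w\<close> is taken out because the denominator may vanish
      there; the filter \<open>at w\<close> ignores it.\<close>
    then have fin: "finite (inverse ` {z. poly P z = 0} - {w})" by simp
    have "eventually (\<lambda>z. z \<in> - (inverse ` {z. poly P z = 0} - {w})) (at w)"
      by (intro eventually_at_in_open' open_Compl finite_imp_closed[OF fin]) simp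
    moreover have "eventually (\<lambda>z. z \<noteq> w) (at w)" by (simp add: eventually_at_filter)
    ultimately show ?thesis
    proof eventually_elim
      case (elim z)
      then have "inverse z \<notin> {z. poly P z = 0}" by (metis Compl_iff Diff_iff image_eqI inverse_inverse_eq singletonD)
      then show ?case by (simp add: divide_inverse)
    qed
  qed
  show ?thesis
  proof
    fix w
    have "eventually (\<lambda>z. poly A (1 / z) / poly B (1 / z) = poly A' (1 / z) / poly B' (1 / z)) (at w)"
      using ev[OF AB(3), of w] ev[OF AB'(3), of w]
    proof eventually_elim
      case (elim z)
      have "poly A (1 / z) * poly B' (1 / z) = poly A' (1 / z) * poly B (1 / z)"
        by (metis eq poly_mult)
      with elim show ?case by (simp add: field_simps)
    qed
    then show "f w = g w" unfolding AB(4) AB'(4) by (rule remove_sings_cong) simp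
  qed
qed

lemma diag_pade_eqI: "is_diag_pade \<phi> n f \<Longrightarrow> diag_pade \<phi> n = f"
  unfolding diag_pade_def by (blast intro: is_diag_pade_unique)

subsection \<open>Equi-Lipschitz families\<close>

text \<open>A finite net turns pointwise into uniform convergence: the Lipschitz bound, common to
  all \<open>g l\<close>, controls the distance to a nearby net point.\<close>

lemma uniform_limit_equi_lipschitz:
  fixes g :: "nat \<Rightarrow> 'a::metric_space \<Rightarrow> 'b::real_normed_vector"
  assumes K: "compact K" and lip: "\<And>l x y. x \<in> K \<Longrightarrow> y \<in> K \<Longrightarrow> dist (g l x) (g l y) \<le> L * dist x y"
    and lim: "\<And>x. x \<in> K \<Longrightarrow> (\<lambda>l. g l x) \<longlonglongrightarrow> 0"
  shows "uniform_limit K g (\<lambda>_. 0) sequentially"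
proof (rule uniform_limitI)
  fix e :: real assume "e > 0"
  \<comment> \<open>\<open>L\<close> may be zero or negative; \<open>L'\<close> is positive, so the
    net radius \<open>r\<close> makes sense and costs at most half of \<open>e\<close>.\<close>
  define L' where "L' = \<bar>L\<bar> + 1"
  have L': "L' > 0" "L \<le> L'" by (auto simp: L'_def)
  define r where "r = e / (2 * L')"
  have r: "r > 0" using \<open>e > 0\<close> L' by (simp add: r_def)
  obtain F where F: "F \<subseteq> K" "finite F" "K \<subseteq> (\<Union>x\<in>F. ball x r)"
  proof (rule compactE_image[OF K, of K "\<lambda>x. ball x r"])
    show "K \<subseteq> (\<Union>x\<in>K. ball x r)" using r by force
  qed auto
  have "\<forall>x\<in>F. eventually (\<lambda>l. dist (g l x) 0 < e / 2) sequentially"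
    using F(1) lim \<open>e > 0\<close> by (intro ballI tendstoD) auto
  then have "eventually (\<lambda>l. \<forall>x\<in>F. dist (g l x) 0 < e / 2) sequentially"
    using F(2) by (simp add: eventually_ball_finite)
  then show "eventually (\<lambda>l. \<forall>x\<in>K. dist (g l x) 0 < e) sequentially"
  proof eventually_elim
    case (elim l)
    show ?case
    proof
      fix x assume x: "x \<in> K"
      then obtain y where y: "y \<in> F" "dist y x < r" using F(3) by auto
      have "dist (g l x) (g l y) \<le> L * dist x y" using lip x y F(1) by blast
      also have "\<dots> \<le> L' * dist x y" using L' by (intro mult_right_mono) auto
      also have "\<dots> < L' * r" using L' y by (simp add: dist_commute)
      also have "\<dots> = e / 2" using L' by (simp add: r_def)
      finally have "dist (g l x) (g l y) < e / 2" .
      moreover have "dist (g l y) 0 < e / 2" using elim y by blast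
      ultimately show "dist (g l x) 0 < e" using dist_triangle[of "g l x" 0 "g l y"] by linarith
    qed
  qed
qed

subsection \<open>The Hankel matrix of a monic polynomial\<close>

text \<open>The matrix is triangular with respect to the antidiagonal, with ones on it, so back
  substitution from the last row upwards gives a trivial kernel.\<close>

lemma E_matrix_inverse:
  assumes "lead_coeff q = 1"
  obtains B where "mat_inverse (E_matrix q) = Some B" "B \<in> carrier_mat (degree q) (degree q)"
    "E_matrix q * B = 1\<^sub>m (degree q)"
proof -
  define k where "k = degree q"
  have E: "E_matrix q \<in> carrier_mat k k" by (simp add: E_matrix_def k_def)
  have "v = 0\<^sub>v k" if v: "v \<in> carrier_vec k" "E_matrix q *\<^sub>v v = 0\<^sub>v k" for v
  proof -
    have row: "(\<Sum>l<k. coeff q (i + l + 1) * v $ l) = 0" if "i < k" for i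
    proof -
      have "(E_matrix q *\<^sub>v v) $ i = (\<Sum>l<k. coeff q (i + l + 1) * v $ l)"
        using that v(1) by (auto simp: E_matrix_def k_def scalar_prod_def atLeast0LessThan intro!: sum.cong)
      then show ?thesis unfolding v(2) using that by simp
    qed
    have "v $ m = 0" if "m < k" for m
      using that
    proof (induction m rule: less_induct)
      case (less m)
      \<comment> \<open>Row \<open>k - 1 - m\<close> reaches the leading coefficient exactly at
        \<open>l = m\<close>; later entries lie beyond the degree, earlier ones meet
        \<open>v $ l = 0\<close> by induction.\<close>
      have "0 = (\<Sum>l<k. coeff q ((k - 1 - m) + l + 1) * v $ l)"
        using less(2) by (intro row[symmetric]) auto
      also have "\<dots> = (\<Sum>l<k. if l = m then v $ m else 0)"
      proof (intro sum.cong refl)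
        fix l assume "l \<in> {..<k}"
        consider "l < m" | "l = m" | "l > m" by linarith
        then show "coeff q ((k - 1 - m) + l + 1) * v $ l = (if l = m then v $ m else 0)"
        proof cases
          case 2
          then have "(k - 1 - m) + l + 1 = degree q" using less(2) by (simp add: k_def)
          then show ?thesis using 2 assms by simp
        next
          case 3
          then have "(k - 1 - m) + l + 1 > degree q" using less(2) by (simp add: k_def)
          then show ?thesis using 3 by (simp add: coeff_eq_0)
        qed (use less in auto)
      qed
      finally show ?case using less(2) by simp
    qed
    then show ?thesis using v by (intro eq_vecI) auto
  qed
  then have "det (E_matrix q) \<noteq> 0" using det_0_iff_vec_prod_zero[OF E] by blast
  then have "E_matrix q \<in> Units (ring_mat TYPE(real) k ())" by (rule det_non_zero_imp_unit[OF E])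
  then obtain B where B: "mat_inverse (E_matrix q) = Some B"
    using mat_inverse(1)[OF E, of "()"] by (cases "mat_inverse (E_matrix q)") auto
  with mat_inverse(2)[OF E B] show ?thesis unfolding k_def by (intro that) blast+
qed

text \<open>The last row of \<open>E_matrix q\<close> is \<open>(1, 0, ..., 0)\<close>, so the last
  row of the product with its inverse is the first row of the inverse. Only this row of the Gram
  matrix enters the Weyl function, because \<open>e_vec\<close> picks row \<open>0\<close>.\<close>

lemma E_matrix_inverse_first_row:
  assumes "lead_coeff q = 1" "l < degree q"
  shows "the (mat_inverse (E_matrix q)) $$ (0, l) = (if l = degree q - 1 then 1 else 0)"
    and "the (mat_inverse (E_matrix q)) \<in> carrier_mat (degree q) (degree q)"
proof -
  define k where "k = degree q"
  have "k > 0" using assms(2) by (simp add: k_def)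
  obtain B where B: "mat_inverse (E_matrix q) = Some B" "B \<in> carrier_mat k k"
    "E_matrix q * B = 1\<^sub>m k"
    using E_matrix_inverse[OF assms(1)] unfolding k_def by blast
  have "(if l = k - 1 then 1 else 0) = (E_matrix q * B) $$ (k - 1, l)"
    using assms(2) by (auto simp: B(3) k_def)
  also have "\<dots> = (\<Sum>i<k. coeff q (k - 1 + i + 1) * B $$ (i, l))"
    using assms(2) B(2)
    by (auto simp: E_matrix_def k_def scalar_prod_def atLeast0LessThan intro!: sum.cong)
  also have "\<dots> = (\<Sum>i<k. if i = 0 then B $$ (0, l) else 0)"
    using assms(1) by (intro sum.cong refl) (auto simp: k_def coeff_eq_0)
  also have "\<dots> = B $$ (0, l)" using \<open>k > 0\<close> by simp
  finally show "the (mat_inverse (E_matrix q)) $$ (0, l) = (if l = degree q - 1 then 1 else 0)"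
    by (simp add: B(1) k_def)
  show "the (mat_inverse (E_matrix q)) \<in> carrier_mat (degree q) (degree q)"
    using B by (simp add: k_def)
qed

subsection \<open>The rows of a generalized Jacobi matrix\<close>

lemma block_start_0 [simp]: "block_start k 0 = 0"
  by (simp add: block_start_def)

lemma block_start_Suc [simp]: "block_start k (Suc j) = block_start k j + k j"
  by (simp add: block_start_def)

section \<open>Positions inside and between blocks\<close>

locale block_sizes =
  fixes k :: "nat \<Rightarrow> nat"
  assumes size_pos: "\<And>j. k j > 0"
begin

lemma block_start_strict_mono: "strict_mono (block_start k)"
  by (rule strict_mono_Suc_iff[THEN iffD2]) (simp add: size_pos)

lemma block_start_less_iff [simp]: "block_start k i < block_start k j \<longleftrightarrow> i < j"
  by (rule strict_mono_less[OF block_start_strict_mono])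

lemma block_start_le_iff [simp]: "block_start k i \<le> block_start k j \<longleftrightarrow> i \<le> j"
  by (rule strict_mono_less_eq[OF block_start_strict_mono])

lemma block_index_eqI:
  assumes "r < k i" shows "block_index k (block_start k i + r) = i"
  unfolding block_index_def
proof (rule Least_equality)
  show "block_start k i + r < block_start k (Suc i)" using assms by simp
next
  fix j assume "block_start k i + r < block_start k (Suc j)"
  then have "block_start k i < block_start k (Suc j)" by linarith
  then show "i \<le> j" by (simp only: block_start_less_iff)
qed

lemma block_cases:
  obtains i r where "R = block_start k i + r" "r < k i"
proof -
  define i where "i = block_index k R"
  have "R < block_start k (Suc R)"
    using strict_mono_imp_increasing[OF block_start_strict_mono, of "Suc R"] by linarith
  then have up: "R < block_start k (Suc i)"
    unfolding i_def block_index_def by (rule LeastI)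
  have low: "block_start k i \<le> R"
  proof (cases i)
    case (Suc j)
    then have "\<not> R < block_start k (Suc j)"
      unfolding i_def block_index_def by (intro not_less_Least) simp
    then show ?thesis by (simp only: Suc not_less)
  qed simp
  show thesis by (rule that[of i "R - block_start k i"]) (use low up in auto)
qed

lemma block_position_eq_iff:
  assumes "r < k i" "s < k j"
  shows "block_start k i + r = block_start k j + s \<longleftrightarrow> i = j \<and> r = s"
  using block_index_eqI[OF assms(1)] block_index_eqI[OF assms(2)] by auto

lemma block_matrix_entry:
  assumes "r < k i" "s < k j"
  shows "block_matrix k M (block_start k i + r) (block_start k j + s) = M i j $$ (r, s)"
  by (simp add: block_matrix_def block_index_eqI assms)

end

locale gen_jacobi =
  fixes \<epsilon> b :: "nat \<Rightarrow> real" and p :: "nat \<Rightarrow> real poly" and M :: real and N :: nat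
  assumes monic: "\<And>j. lead_coeff (p j) = 1"
    and deg_pos: "\<And>j. degree (p j) > 0"
    and sign: "\<And>j. \<epsilon> j \<in> {1, -1}"
    and b_pos: "\<And>j. b j > 0"
    and deg_le: "\<And>j. degree (p j) \<le> N"
    and b_le: "\<And>j. b j \<le> M"
    and coeff_le: "\<And>j i. i < degree (p j) \<Longrightarrow> \<bar>coeff (p j) i\<bar> \<le> M"

sublocale gen_jacobi \<subseteq> block_sizes "\<lambda>j. degree (p j)"
  by standard (rule deg_pos)

context gen_jacobi
begin

abbreviation H :: "(nat \<Rightarrow> complex) \<Rightarrow> nat \<Rightarrow> complex" where
  "H \<equiv> gen_jacobi_op \<epsilon> p b"

abbreviation n :: "nat \<Rightarrow> nat" where
  "n \<equiv> block_start (\<lambda>j. degree (p j))"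

abbreviation pc :: "nat \<Rightarrow> complex poly" where
  "pc j \<equiv> map_poly complex_of_real (p j)"

text \<open>Apart from the subdiagonal ones of the companion blocks, all nonzero entries of
  \<open>H\<close> stand in last columns of blocks, so blocks interact only through these
  coordinates.\<close>

definition block_last :: "(nat \<Rightarrow> complex) \<Rightarrow> nat \<Rightarrow> complex" where
  "block_last x i = x (n (Suc i) - 1)"

text \<open>The contribution of the neighbouring blocks to the first row of block \<open>i\<close>.
  The case \<open>i = 0\<close> is separate since \<open>i - 1\<close> truncates.\<close>

definition coupling :: "(nat \<Rightarrow> complex) \<Rightarrow> nat \<Rightarrow> complex" where
  "coupling \<tau> i = (if i = 0 then 0 else complex_of_real (b (i - 1)) * \<tau> (i - 1))
    + complex_of_real (\<epsilon> i * \<epsilon> (Suc i) * b i) * \<tau> (Suc i)"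

lemma M_pos: "M > 0"
  using b_pos[of 0] b_le[of 0] by linarith

lemma sign_sq [simp]: "\<epsilon> j * \<epsilon> j = 1"
  using sign[of j] by auto

lemma abs_sign [simp]: "\<bar>\<epsilon> j\<bar> = 1"
  using sign[of j] by auto

lemma block_last_eq: "block_last x i = x (n i + (degree (p i) - 1))"
  using deg_pos[of i] by (simp add: block_last_def Nat.add_diff_assoc)

text \<open>Four kinds of entries occur in a row: a polynomial coefficient, a subdiagonal one and
  the two corners. Each is written as a series with a single nonzero term.\<close>

lemma H_row:
  assumes r: "r < degree (p i)"
  shows "H x (n i + r) = (if r = 0 then coupling (block_last x) i else x (n i + r - 1))
    - complex_of_real (coeff (p i) r) * block_last x i"
proof -
  \<comment> \<open>For \<open>i = 0\<close> and for \<open>r = 0\<close> truncated subtraction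
    yields spurious positions; the factors \<open>f2\<close> and \<open>f1\<close> vanish
    there.\<close>
  define a2 where "a2 = n (i - 1) + (degree (p (i - 1)) - 1)"
  define f1 where "f1 = (if r = 0 then 0 else 1 :: complex)"
  define f2 where "f2 = (if r = 0 \<and> i > 0 then complex_of_real (b (i - 1)) else 0)"
  define f3 where "f3 = (if r = 0 then complex_of_real (\<epsilon> i * \<epsilon> (Suc i) * b i) else 0)"
  have entry: "complex_of_real (gen_jacobi_matrix \<epsilon> p b (n i + r) c) * x c =
      ((if c = n i + (degree (p i) - 1) then - complex_of_real (coeff (p i) r) * x c else 0)
      + (if c = n i + (r - 1) then f1 * x c else 0))
      + ((if c = a2 then f2 * x c else 0)
      + (if c = n (Suc i) + (degree (p (Suc i)) - 1) then f3 * x c else 0))" for c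
  proof -
    obtain j s where c: "c = n j + s" and s: "s < degree (p j)" by (rule block_cases)
    have lasts: "degree (p j) - 1 < degree (p j)" "r - 1 < degree (p i)" for j
      using deg_pos[of j] r by auto
    have m: "gen_jacobi_matrix \<epsilon> p b (n i + r) c = jacobi_block \<epsilon> p b i j $$ (r, s)"
      unfolding gen_jacobi_matrix_def c by (rule block_matrix_entry[OF r s])
    have e0: "c = n l + (degree (p l) - 1) \<longleftrightarrow> j = l \<and> s = degree (p l) - 1" for l
      unfolding c by (rule block_position_eq_iff[OF s lasts(1)])
    have e1: "c = n i + (r - 1) \<longleftrightarrow> j = i \<and> s = r - 1"
      unfolding c by (rule block_position_eq_iff[OF s lasts(2)])
    have e2: "(if c = a2 then f2 * x c else 0)
        = (if i = Suc j \<and> s = degree (p j) - 1 then f2 * x c else 0)"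
      by (cases i) (use e0[of "i - 1"] in \<open>auto simp: f2_def a2_def\<close>)
    consider "j = i" | "i = Suc j" | "j = Suc i" | "j \<noteq> i" "i \<noteq> Suc j" "j \<noteq> Suc i" by blast
    then show ?thesis
    proof cases
      case 1
      show ?thesis
      proof (cases "s = degree (p i) - 1")
        case True
        \<comment> \<open>The subdiagonal never meets the last column; \<open>r \<noteq> 0\<close>
          excludes the truncated \<open>r - 1\<close> when the block has size one.\<close>
        have "\<not> (s = r - 1 \<and> r \<noteq> 0)" using r True by linarith
        then show ?thesis
          unfolding m e0 e1 e2 using 1 r s True by (auto simp: jacobi_block_def companion_matrix_def f1_def)
      next
        case False
        have "r = Suc s \<longleftrightarrow> s = r - 1 \<and> r \<noteq> 0" by auto
        then show ?thesis
          unfolding m e0 e1 e2 using 1 r s False by (auto simp: jacobi_block_def companion_matrix_def f1_def)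
      qed
    next
      case 2
      then show ?thesis unfolding m e0 e1 e2 using r s
        by (simp add: jacobi_block_def upper_right_corner_mat_def f2_def)
    next
      case 3
      then show ?thesis unfolding m e0 e1 e2 using r s
        by (simp add: jacobi_block_def upper_right_corner_mat_def f3_def)
    next
      case 4
      then show ?thesis unfolding m e0 e1 e2 using r s by (simp add: jacobi_block_def)
    qed
  qed
  have "(\<lambda>c. complex_of_real (gen_jacobi_matrix \<epsilon> p b (n i + r) c) * x c) sums
      ((- complex_of_real (coeff (p i) r) * x (n i + (degree (p i) - 1)) + f1 * x (n i + (r - 1)))
      + (f2 * x a2 + f3 * x (n (Suc i) + (degree (p (Suc i)) - 1))))"
    unfolding entry by (intro sums_add sums_single)
  then have "H x (n i + r) = (- complex_of_real (coeff (p i) r) * block_last x i + f1 * x (n i + (r - 1)))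
      + (f2 * block_last x (i - 1) + f3 * block_last x (Suc i))"
    unfolding inf_mat_op_def block_last_eq a2_def by (rule sums_unique[symmetric])
  then show ?thesis
    by (cases "r = 0") (auto simp: coupling_def f1_def f2_def f3_def)
qed

lemma block_last_linear:
  "block_last (\<lambda>i. c * x i - y i) i = c * block_last x i - block_last y i"
  by (simp add: block_last_def)

lemma H_linear: "H (\<lambda>i. c * x i - y i) = (\<lambda>i. c * H x i - H y i)"
proof
  fix R
  obtain i r where R: "R = n i + r" and r: "r < degree (p i)" by (rule block_cases)
  show "H (\<lambda>i. c * x i - y i) R = c * H x R - H y R"
    unfolding R H_row[OF r] block_last_linear coupling_def by (simp add: algebra_simps)
qed

lemma H_diff: "H (\<lambda>i. x i - y i) = (\<lambda>i. H x i - H y i)"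
  using H_linear[of 1 x y] by simp

lemma H_cmult: "H (\<lambda>i. c * x i) = (\<lambda>i. c * H x i)"
proof -
  have "H (\<lambda>_. 0) = (\<lambda>_. 0)" by (simp add: inf_mat_op_def)
  then show ?thesis using H_linear[of c x "\<lambda>_. 0"] by simp
qed

text \<open>A row reaches back by one position only and forward at most to the end of the next
  block. The constant covers two couplings and one coefficient of size \<open>M\<close> each, plus a
  subdiagonal one. That the window starts at \<open>R - 1\<close> is what
  \<open>galerkin_decay\<close> exploits.\<close>

lemma H_local_bound:
  assumes S: "\<And>c. R - 1 \<le> c \<Longrightarrow> c \<le> R + 2 * N \<Longrightarrow> cmod (x c) \<le> S"
  shows "cmod (H x R) \<le> (3 * M + 1) * S"
proof -
  obtain i r where R: "R = n i + r" and r: "r < degree (p i)" by (rule block_cases)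
  have "S \<ge> 0" using norm_ge_zero S[of R] by (meson diff_le_self le_add1 order_trans)
  have l1: "cmod (block_last x i) \<le> S"
    unfolding block_last_def by (rule S) (use r deg_le[of i] in \<open>auto simp: R\<close>)
  have l2: "cmod (block_last x (Suc i)) \<le> S"
    unfolding block_last_def by (rule S) (use r deg_le[of i] deg_le[of "Suc i"] in \<open>auto simp: R\<close>)
  have a: "cmod (complex_of_real (coeff (p i) r) * block_last x i) \<le> M * S"
    using coeff_le[OF r] l1 by (auto simp: norm_mult intro!: mult_mono)
  have bt: "cmod (complex_of_real (b j) * u) \<le> M * S" if "cmod u \<le> S" for j u
    using that b_pos[of j] b_le[of j] M_pos by (auto simp: norm_mult intro!: mult_mono)
  have "cmod (if r = 0 then coupling (block_last x) i else x (n i + r - 1)) \<le> (2 * M + 1) * S"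
  proof (cases "r = 0")
    case True
    have "cmod (if i = 0 then 0 else complex_of_real (b (i - 1)) * block_last x (i - 1)) \<le> M * S"
    proof (cases i)
      case (Suc j)
      have "cmod (block_last x j) \<le> S"
        unfolding block_last_def by (rule S) (auto simp: R Suc True)
      then show ?thesis using bt by (simp add: Suc)
    qed (use M_pos \<open>S \<ge> 0\<close> in simp)
    moreover have "cmod (complex_of_real (\<epsilon> i * \<epsilon> (Suc i) * b i) * block_last x (Suc i)) \<le> M * S"
      using bt[OF l2, of i] by (simp add: norm_mult)
    ultimately have "cmod (coupling (block_last x) i) \<le> M * S + M * S"
      unfolding coupling_def by (intro norm_triangle_mono)
    then show ?thesis using True \<open>S \<ge> 0\<close> by (simp add: algebra_simps)
  next
    case False
    then have "cmod (x (n i + r - 1)) \<le> S" by (intro S) (auto simp: R)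
    moreover have "0 \<le> 2 * M * S" using M_pos \<open>S \<ge> 0\<close> by simp
    ultimately show ?thesis using False by (simp add: algebra_simps)
  qed
  then have "cmod (H x R) \<le> (2 * M + 1) * S + M * S"
    unfolding R H_row[OF r] by (intro norm_triangle_le_diff add_mono a)
  then show ?thesis by (simp add: algebra_simps)
qed

section \<open>Boundedness of \<open>H\<close> and of its numerical range\<close>

definition K :: real where "K = 3 * M + 1"

definition H_norm_bound :: real where
  "H_norm_bound = K * (2 * real (2 * N) + 1) * (real (2 * N) + 1)"

lemma K_pos: "K > 0" using M_pos by (simp add: K_def)

lemma H_ell2:
  assumes "x \<in> ell2"
  shows "H x \<in> ell2" and "l2_norm (H x) \<le> H_norm_bound * l2_norm x"
proof -
  have "cmod (H x R) \<le> K * (\<Sum>d\<le>2 * (2 * N). cmod (x (R + d - 2 * N)))" for R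
    unfolding K_def
  proof (rule H_local_bound)
    fix c assume c: "R - 1 \<le> c" "c \<le> R + 2 * N"
    \<comment> \<open>Since \<open>N > 0\<close>, position \<open>R - 1\<close> also lies in the
      symmetric band of half-width \<open>2 * N\<close>, and \<open>c\<close> is reached by the
      shift \<open>c + 2 * N - R\<close>.\<close>
    have "N > 0" using deg_pos[of 0] deg_le[of 0] by linarith
    with c have "c + 2 * N - R \<le> 2 * (2 * N)" "R + (c + 2 * N - R) - 2 * N = c" by auto
    then show "cmod (x c) \<le> (\<Sum>d\<le>2 * (2 * N). cmod (x (R + d - 2 * N)))"
      using member_le_sum[of "c + 2 * N - R" "{..2 * (2 * N)}" "\<lambda>d. cmod (x (R + d - 2 * N))"] by simp
  qed
  from band_operator_bounded[OF assms less_imp_le[OF K_pos] this]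
  show "H x \<in> ell2" and "l2_norm (H x) \<le> H_norm_bound * l2_norm x"
    by (simp_all add: H_norm_bound_def)
qed

lemma numerical_range_bounded:
  assumes "w \<in> numerical_range H" shows "cmod w \<le> H_norm_bound"
proof -
  obtain y where y: "y \<in> ell2" "l2_norm y = 1" "w = l2_inner (H y) y"
    using assms by (auto simp: numerical_range_def)
  then show ?thesis
    using l2_Cauchy_Schwarz[OF H_ell2(1)[OF y(1)] y(1)] H_ell2(2)[OF y(1)] by simp
qed

lemma H_coercive:
  assumes "\<And>w. w \<in> numerical_range H \<Longrightarrow> \<delta> \<le> dist w z" "y \<in> ell2"
  shows "\<delta> * (l2_norm y)\<^sup>2 \<le> cmod (l2_inner (\<lambda>i. H y i - z * y i) y)"
  by (rule numerical_range_coercive) (use assms H_ell2 H_cmult in auto)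

subsection \<open>Reduction to a three-term recurrence\<close>

lemma telescoping_row_sum:
  fixes z c :: complex
  shows "(\<Sum>r<Suc m. z ^ r * ((if r = 0 then c else y (r - 1)) - z * y r)) = c - z ^ Suc m * y m"
  by (induction m) (simp_all add: algebra_simps)

lemma pc_eval: "poly (pc i) z = (\<Sum>r<degree (p i). complex_of_real (coeff (p i) r) * z ^ r) + z ^ degree (p i)"
proof -
  have "poly (pc i) z = (\<Sum>r\<le>degree (p i). complex_of_real (coeff (p i) r) * z ^ r)"
    by (simp add: poly_altdef degree_map_poly coeff_map_poly)
  then show ?thesis using monic[of i] by (simp add: lessThan_Suc_atMost[symmetric])
qed

text \<open>Weighting the rows of a block with powers of \<open>z\<close> makes the inner
  coordinates telescope away; what remains links consecutive last coordinates.\<close>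

lemma H_row_sum:
  "(\<Sum>r<degree (p i). z ^ r * (H x (n i + r) - z * x (n i + r)))
    = coupling (block_last x) i - poly (pc i) z * block_last x i"
proof -
  obtain m where m: "degree (p i) = Suc m" using deg_pos[of i] gr0_conv_Suc by blast
  let ?y = "\<lambda>r. x (n i + r)"
  have last: "block_last x i = ?y m" by (simp add: block_last_eq m)
  have "(\<Sum>r<Suc m. z ^ r * (H x (n i + r) - z * x (n i + r)))
      = (\<Sum>r<Suc m. z ^ r * ((if r = 0 then coupling (block_last x) i else ?y (r - 1)) - z * ?y r)
          - (complex_of_real (coeff (p i) r) * z ^ r) * block_last x i)"
  proof (intro sum.cong refl)
    fix r assume "r \<in> {..<Suc m}"
    then have r: "r < degree (p i)" by (simp add: m)
    show "z ^ r * (H x (n i + r) - z * x (n i + r))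
      = z ^ r * ((if r = 0 then coupling (block_last x) i else ?y (r - 1)) - z * ?y r)
          - (complex_of_real (coeff (p i) r) * z ^ r) * block_last x i"
      unfolding H_row[OF r] by (cases r) (simp_all add: algebra_simps)
  qed
  also have "\<dots> = coupling (block_last x) i - z ^ Suc m * ?y m
      - (\<Sum>r<Suc m. complex_of_real (coeff (p i) r) * z ^ r) * block_last x i"
    using telescoping_row_sum[of z "coupling (block_last x) i" ?y m]
    by (simp only: sum_subtractf sum_distrib_right)
  also have "\<dots> = coupling (block_last x) i - poly (pc i) z * block_last x i"
    by (simp add: pc_eval m last algebra_simps)
  finally show ?thesis by (simp only: m)
qed

text \<open>The rows of \<open>(H - z) x = 0\<close> other than the first row of each block are Horner's scheme: they
  determine a block from its last coordinate.\<close>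

definition horner_extension :: "complex \<Rightarrow> (nat \<Rightarrow> complex) \<Rightarrow> nat \<Rightarrow> complex" where
  "horner_extension z \<tau> R = (let i = block_index (\<lambda>j. degree (p j)) R
     in poly (poly_shift (Suc (R - n i)) (pc i)) z * \<tau> i)"

lemma horner_extension_eq:
  "r < degree (p i) \<Longrightarrow> horner_extension z \<tau> (n i + r) = poly (poly_shift (Suc r) (pc i)) z * \<tau> i"
  by (simp add: horner_extension_def block_index_eqI)

lemma block_last_horner [simp]: "block_last (horner_extension z \<tau>) = \<tau>"
proof
  fix i
  have "poly_shift (degree (p i)) (pc i) = 1"
    using monic[of i] by (intro poly_eqI) (auto simp: coeff_poly_shift coeff_map_poly coeff_eq_0)
  then show "block_last (horner_extension z \<tau>) i = \<tau> i"
    unfolding block_last_eq using horner_extension_eq[of "degree (p i) - 1" i z \<tau>] deg_pos[of i]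
    by simp
qed

lemma poly_shift_unfold: "poly q z = coeff q 0 + z * poly (poly_shift 1 q) z"
proof -
  have "q = pCons (coeff q 0) (poly_shift 1 q)"
    by (intro poly_eqI) (simp add: coeff_pCons coeff_poly_shift split: nat.split)
  then show ?thesis by (metis poly_pCons)
qed

lemma horner_step:
  fixes q :: "complex poly"
  shows "poly (poly_shift r q) z = coeff q r + z * poly (poly_shift (Suc r) q) z"
proof -
  have "poly_shift 1 (poly_shift r q) = poly_shift (Suc r) q"
    by (intro poly_eqI) (simp add: coeff_poly_shift)
  then show ?thesis using poly_shift_unfold[of "poly_shift r q" z] by (simp add: coeff_poly_shift)
qed

text \<open>The converse direction to \<open>H_row_sum\<close>: any \<open>\<tau>\<close> extends to
  a vector whose residual sits in the first rows of the blocks, where it is the defect in the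
  three-term recurrence.\<close>

lemma H_horner:
  assumes r: "r < degree (p i)"
  shows "H (horner_extension z \<tau>) (n i + r) - z * horner_extension z \<tau> (n i + r)
    = (if r = 0 then coupling \<tau> i - poly (pc i) z * \<tau> i else 0)"
proof (cases r)
  case 0
  have "poly_shift 0 (pc i) = pc i" by (intro poly_eqI) (simp add: coeff_poly_shift)
  then have "poly (pc i) z = coeff (p i) 0 + z * poly (poly_shift (Suc 0) (pc i)) z"
    using horner_step[of 0 "pc i" z] by (simp add: coeff_map_poly)
  then show ?thesis using r 0
    unfolding H_row[OF r] horner_extension_eq[OF r] by (simp add: algebra_simps)
next
  case (Suc s)
  have "horner_extension z \<tau> (n i + r - 1) = poly (poly_shift r (pc i)) z * \<tau> i"
    using horner_extension_eq[of s i z \<tau>] r Suc by simp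
  then show ?thesis
    unfolding H_row[OF r] horner_extension_eq[OF r] using horner_step[of r "pc i" z] Suc
    by (simp add: coeff_map_poly algebra_simps)
qed

subsection \<open>The Weyl function\<close>

text \<open>Pairing with \<open>e_vec\<close> reads off row \<open>0\<close> of the Gram matrix,
  whose only nonzero entry is \<open>\<epsilon> 0\<close> at the last position of block
  \<open>0\<close>.\<close>

lemma weyl_function_eq:
  "weyl_function \<epsilon> p b z = \<epsilon> 0 * block_last (resolvent H z e_vec) 0"
proof -
  define x where "x = resolvent H z e_vec"
  have "complex_of_real (gram_matrix \<epsilon> p 0 c) * x c
      = (if c = degree (p 0) - 1 then complex_of_real (\<epsilon> 0) * x c else 0)" for c
  proof -
    obtain j s where c: "c = n j + s" and s: "s < degree (p j)" by (rule block_cases)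
    have m: "gram_matrix \<epsilon> p 0 c = gram_block \<epsilon> p 0 j $$ (0, s)"
      using block_matrix_entry[OF deg_pos[of 0] s, of "gram_block \<epsilon> p"]
      by (simp add: gram_matrix_def c)
    have e: "c = degree (p 0) - 1 \<longleftrightarrow> j = 0 \<and> s = degree (p 0) - 1"
      using block_position_eq_iff[OF s, of "degree (p 0) - 1" 0] deg_pos[of 0] by (simp add: c)
    show ?thesis
      unfolding m e using s deg_pos[of 0] E_matrix_inverse_first_row[OF monic[of 0], of s]
      by (auto simp: gram_block_def)
  qed
  then have "inf_mat_op (gram_matrix \<epsilon> p) x 0 = (\<Sum>c. if c = degree (p 0) - 1 then complex_of_real (\<epsilon> 0) * x c else 0)"
    by (simp add: inf_mat_op_def)
  also have "\<dots> = \<epsilon> 0 * x (degree (p 0) - 1)"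
    by (rule sums_unique[symmetric]) (rule sums_single)
  finally have "inf_mat_op (gram_matrix \<epsilon> p) x 0 = \<epsilon> 0 * block_last x 0"
    by (simp add: block_last_def)
  moreover have "l2_inner y e_vec = y 0" for y
    using l2_inner_single[of y e_vec] by (simp add: e_vec_def)
  ultimately show ?thesis
    by (simp add: weyl_function_def indef_inner_def x_def)
qed

subsection \<open>The polynomials of the first and second kind\<close>

fun recurrence_poly :: "complex poly \<Rightarrow> complex poly \<Rightarrow> nat \<Rightarrow> complex poly" where
  "recurrence_poly u v 0 = u"
| "recurrence_poly u v (Suc 0) = v"
| "recurrence_poly u v (Suc (Suc j)) = Polynomial.smult (1 / complex_of_real (b (Suc j)))
     (pc (Suc j) * recurrence_poly u v (Suc j)
      - Polynomial.smult (complex_of_real (\<epsilon> j * \<epsilon> (Suc j) * b j)) (recurrence_poly u v j))"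

definition P :: "nat \<Rightarrow> complex poly" where
  "P = recurrence_poly 1 (Polynomial.smult (1 / complex_of_real (b 0)) (pc 0))"

definition Q :: "nat \<Rightarrow> complex poly" where
  "Q = recurrence_poly 0 [:complex_of_real (\<epsilon> 0 / b 0):]"

lemma b_nonzero [simp]: "b j \<noteq> 0"
  using b_pos[of j] by simp

lemma degree_pc [simp]: "degree (pc j) = degree (p j)"
  by (rule degree_map_poly) simp

lemma pc_nonzero [simp]: "pc j \<noteq> 0"
  using deg_pos[of j] degree_pc[of j] by force

lemma recurrence_poly_step:
  "complex_of_real (b (Suc j)) * poly (recurrence_poly u v (Suc (Suc j))) z
    = poly (pc (Suc j)) z * poly (recurrence_poly u v (Suc j)) z
      - complex_of_real (\<epsilon> j * \<epsilon> (Suc j) * b j) * poly (recurrence_poly u v j) z"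
  by simp

text \<open>The product with \<open>pc\<close> dominates because block starts increase strictly. The
  exact degree makes \<open>reflect_poly (P j)\<close> at \<open>1 / z\<close> equal to
  \<open>P j\<close> divided by \<open>z ^ n j\<close>.\<close>

lemma degree_P: "P j \<noteq> 0 \<and> degree (P j) = n j"
proof (induction j rule: less_induct)
  case (less j)
  consider "j = 0" | "j = 1" | i where "j = Suc (Suc i)"
    by (metis One_nat_def not0_implies_Suc)
  then show ?case
  proof cases
    case 3
    have IH: "P i \<noteq> 0" "degree (P i) = n i" "P (Suc i) \<noteq> 0" "degree (P (Suc i)) = n (Suc i)"
      using less 3 by auto
    let ?A = "pc (Suc i) * P (Suc i)"
    let ?B = "Polynomial.smult (complex_of_real (\<epsilon> i * \<epsilon> (Suc i) * b i)) (P i)"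
    have A: "degree ?A = n j"
      using IH by (subst degree_mult_eq) (auto simp: 3)
    have "degree ?B \<le> n i" using degree_smult_le[of _ "P i"] IH(2) by simp
    also have "\<dots> < n j" by (simp only: block_start_less_iff 3)
    finally have d: "degree (?A + - ?B) = n j"
      using A by (subst degree_add_eq_left) simp_all
    have Pj: "P j = Polynomial.smult (1 / complex_of_real (b (Suc i))) (?A + - ?B)"
      by (simp add: P_def 3)
    have "n j > 0" using block_start_less_iff[of 0 j] by (simp add: 3)
    then show ?thesis unfolding Pj using d by force
  qed (auto simp: P_def)
qed

lemma degree_Q: "degree (Q j) \<le> n j"
proof (induction j rule: less_induct)
  case (less j)
  consider "j = 0" | "j = 1" | i where "j = Suc (Suc i)"
    by (metis One_nat_def not0_implies_Suc)
  then show ?case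
  proof cases
    case 3
    have IH: "degree (Q i) \<le> n i" "degree (Q (Suc i)) \<le> n (Suc i)"
      using less[of i] less[of "Suc i"] 3 by simp_all
    let ?A = "pc (Suc i) * Q (Suc i)"
    let ?B = "Polynomial.smult (complex_of_real (\<epsilon> i * \<epsilon> (Suc i) * b i)) (Q i)"
    have A: "degree ?A \<le> n j"
      using degree_mult_le[of "pc (Suc i)" "Q (Suc i)"] IH by (simp add: 3)
    have "degree ?B \<le> n i" using degree_smult_le[of _ "Q i"] IH(1) order_trans by blast
    also have "\<dots> \<le> n j" by (simp only: block_start_le_iff 3)
    finally have "degree (?A - ?B) \<le> n j" using A by (intro degree_diff_le)
    then show ?thesis
      using degree_smult_le[of "1 / complex_of_real (b (Suc i))" "?A - ?B"]
      by (simp add: Q_def 3)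
  qed (auto simp: Q_def)
qed

text \<open>Multiplying by \<open>\<epsilon> i\<close> shifts the sign product from the lower
  neighbour, where the recurrence of \<open>P\<close> and \<open>Q\<close> has it, to the upper one,
  where \<open>H\<close> has it. The \<open>P\<close> part solves the homogeneous recurrence; the
  \<open>Q\<close> part carries the right-hand side \<open>c\<close> at
  \<open>i = 0\<close>.\<close>

lemma recurrence_solution:
  fixes c \<alpha> z :: complex
  defines "\<tau> \<equiv> \<lambda>i. complex_of_real (\<epsilon> i) * (c * poly (Q i) z + \<alpha> * poly (P i) z)"
  shows "coupling \<tau> i - poly (pc i) z * \<tau> i = (if i = 0 then c else 0)"
proof (cases i)
  case 0
  have e: "complex_of_real (\<epsilon> j) * complex_of_real (\<epsilon> j) = 1" for j
    by (metis of_real_1 of_real_mult sign_sq)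
  have "coupling \<tau> i = (complex_of_real (\<epsilon> 1) * complex_of_real (\<epsilon> 1))
      * ((complex_of_real (\<epsilon> 0) * complex_of_real (\<epsilon> 0)) * c
         + complex_of_real (\<epsilon> 0) * \<alpha> * poly (pc 0) z)"
    by (simp add: 0 coupling_def \<tau>_def P_def Q_def field_simps)
  then show ?thesis unfolding e by (simp add: 0 \<tau>_def P_def Q_def)
next
  case (Suc j)
  have e: "complex_of_real (\<epsilon> j) * complex_of_real (\<epsilon> j) = 1" for j
    by (metis of_real_1 of_real_mult sign_sq)
  have e': "complex_of_real (\<epsilon> j) * (complex_of_real (\<epsilon> j) * w) = w" for j w
    using e[of j] by (simp add: mult.assoc[symmetric])
  let ?u = "\<lambda>i. c * poly (Q i) z + \<alpha> * poly (P i) z"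
  have "complex_of_real (b (Suc j)) * ?u (Suc (Suc j))
      = c * (complex_of_real (b (Suc j)) * poly (Q (Suc (Suc j))) z)
        + \<alpha> * (complex_of_real (b (Suc j)) * poly (P (Suc (Suc j))) z)"
    by (simp only: distrib_left mult.left_commute)
  also have "\<dots> = poly (pc (Suc j)) z * ?u (Suc j)
      - complex_of_real (\<epsilon> j * \<epsilon> (Suc j) * b j) * ?u j"
    unfolding P_def Q_def recurrence_poly_step by (simp only: ring_distribs mult_ac) simp
  finally have rec: "complex_of_real (b (Suc j)) * ?u (Suc (Suc j))
      = poly (pc (Suc j)) z * ?u (Suc j) - complex_of_real (\<epsilon> j * \<epsilon> (Suc j) * b j) * ?u j" .
  have "coupling \<tau> i = complex_of_real (b j) * \<tau> j
      + complex_of_real (\<epsilon> i) * (complex_of_real (b (Suc j)) * ?u (Suc (Suc j)))"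
    by (simp add: Suc coupling_def \<tau>_def mult_ac e')
  also have "\<dots> = poly (pc i) z * \<tau> i"
    unfolding rec \<tau>_def Suc using e[of "Suc j"] by (simp add: algebra_simps e')
  finally show ?thesis by (simp add: Suc)
qed

subsection \<open>Finite sections\<close>

text \<open>The case \<open>c = 0\<close>, \<open>\<alpha> = 1\<close> gives a null vector of the
  section when \<open>P j\<close> vanishes at \<open>z\<close>; \<open>c = 1\<close> with
  \<open>\<alpha> = - Q j / P j\<close> gives the solution of the section.\<close>

definition section_vector :: "complex \<Rightarrow> complex \<Rightarrow> nat \<Rightarrow> complex \<Rightarrow> nat \<Rightarrow> complex" where
  "section_vector c \<alpha> j z = horner_extension z
     (\<lambda>i. if i < j then complex_of_real (\<epsilon> i) * (c * poly (Q i) z + \<alpha> * poly (P i) z) else 0)"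

lemma section_vector_support:
  assumes "R \<ge> n j" shows "section_vector c \<alpha> j z R = 0"
proof -
  obtain i r where R: "R = n i + r" "r < degree (p i)" by (rule block_cases)
  have "n j < n (Suc i)" using assms R by simp
  then have "\<not> i < j" by (simp only: block_start_less_iff)
  then show ?thesis by (simp add: R section_vector_def horner_extension_eq)
qed

lemma section_vector_ell2: "section_vector c \<alpha> j z \<in> ell2"
  by (rule ell2_finite_support) (rule section_vector_support)

text \<open>Within the section, the cut at block \<open>j\<close> can be felt only in block
  \<open>j - 1\<close>, whose coupling involves index \<open>j\<close>; there the uncut combination
  is zero by \<open>root\<close>, so cutting changes nothing.\<close>

lemma section_vector_row:
  assumes root: "c * poly (Q j) z + \<alpha> * poly (P j) z = 0" and "R < n j"
  shows "H (section_vector c \<alpha> j z) R - z * section_vector c \<alpha> j z R = c * e_vec R"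
proof -
  obtain i r where R: "R = n i + r" and r: "r < degree (p i)" by (rule block_cases)
  have "n i < n j" using assms(2) R by linarith
  then have i: "i < j" by (simp only: block_start_less_iff)
  let ?u = "\<lambda>i. complex_of_real (\<epsilon> i) * (c * poly (Q i) z + \<alpha> * poly (P i) z)"
  let ?\<tau> = "\<lambda>i. if i < j then ?u i else 0"
  have "?\<tau> (Suc i) = ?u (Suc i)" using root i by (cases "Suc i = j") auto
  then have "coupling ?\<tau> i = coupling ?u i" using i by (simp add: coupling_def)
  then have "coupling ?\<tau> i - poly (pc i) z * ?\<tau> i = (if i = 0 then c else 0)"
    using i recurrence_solution[of c z \<alpha> i] by simp
  moreover have "e_vec R = (if i = 0 \<and> r = 0 then 1 else 0)"
    using block_start_less_iff[of 0 i] by (auto simp: e_vec_def R)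
  ultimately show ?thesis
    using H_horner[OF r, of z ?\<tau>] unfolding section_vector_def[symmetric] R by simp
qed

text \<open>This form of \<open>(H - z) x = e\<close> is satisfied by the solutions of the infinite system and of all its
  finite sections alike.\<close>

definition galerkin :: "complex \<Rightarrow> (nat \<Rightarrow> complex) \<Rightarrow> bool" where
  "galerkin z x \<longleftrightarrow> x \<in> ell2 \<and> (\<forall>R. x R = 0 \<or> H x R - z * x R = e_vec R)"

section \<open>A priori bounds at positive distance from the numerical range\<close>

definition gap :: "real \<Rightarrow> complex \<Rightarrow> bool" where
  "gap \<delta> z \<longleftrightarrow> \<delta> > 0 \<and> (\<forall>w\<in>numerical_range H. \<delta> \<le> dist w z)"

lemma gap_coercive:
  assumes "gap \<delta> z" "y \<in> ell2"
  shows "\<delta> * (l2_norm y)\<^sup>2 \<le> cmod (l2_inner (\<lambda>i. H y i - z * y i) y)"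
  using assms by (intro H_coercive) (auto simp: gap_def)

text \<open>Testing with \<open>x\<close> itself: the residual equals \<open>e_vec\<close> on the
  support of \<open>x\<close>, so the quadratic form is just \<open>cnj (x 0)\<close>, which is at
  most linear in the norm, while the coercive lower bound is quadratic.\<close>

lemma galerkin_bound:
  assumes "gap \<delta> z" "galerkin z x"
  shows "l2_norm x \<le> 1 / \<delta>"
proof (cases "l2_norm x = 0")
  case False
  have x: "x \<in> ell2" using assms(2) by (simp add: galerkin_def)
  have pos: "l2_norm x > 0" using False x by (simp add: less_le)
  have "l2_inner (\<lambda>i. H x i - z * x i) x = (H x 0 - z * x 0) * cnj (x 0)"
  proof (rule l2_inner_single)
    fix i :: nat assume "i \<noteq> 0"
    then show "(H x i - z * x i) * cnj (x i) = 0"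
      using assms(2) by (cases "x i = 0") (auto simp: galerkin_def e_vec_def)
  qed
  also have "\<dots> = cnj (x 0)"
    using assms(2) by (cases "x 0 = 0") (auto simp: galerkin_def e_vec_def)
  finally have "\<delta> * (l2_norm x)\<^sup>2 \<le> cmod (x 0)"
    using gap_coercive[OF assms(1) x] by simp
  also have "\<dots> \<le> l2_norm x" by (rule cmod_le_l2_norm[OF x])
  finally have "l2_norm x * (\<delta> * l2_norm x) \<le> l2_norm x * 1"
    by (simp add: power2_eq_square mult_ac)
  then have "\<delta> * l2_norm x \<le> 1" using pos by (simp only: mult_le_cancel_left_pos)
  then show ?thesis using assms(1) by (simp add: gap_def field_simps)
qed (use assms in \<open>simp add: gap_def\<close>)

text \<open>At a zero of \<open>P j\<close> the section has a null vector, whose residual lives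
  outside its support. Its quadratic form vanishes, so coercivity forces it to be zero, although its
  last coordinate in block \<open>0\<close> is \<open>\<epsilon> 0\<close>.\<close>

lemma P_nonzero:
  assumes "gap \<delta> z" shows "poly (P j) z \<noteq> 0"
proof
  assume root: "poly (P j) z = 0"
  let ?x = "section_vector 0 1 j z"
  \<comment> \<open>Block \<open>0\<close> must belong to the section; \<open>P 0 = 1\<close> has no
    zero.\<close>
  have "j \<noteq> 0" using root by (cases j) (auto simp: P_def)
  have zero: "(H ?x i - z * ?x i) * cnj (?x i) = 0" for i
    using section_vector_row[of 0 j z 1 i] section_vector_support[of j i 0 1 z] root
    by (cases "i < n j") auto
  have "l2_inner (\<lambda>i. H ?x i - z * ?x i) ?x = 0"
    by (simp only: l2_inner_def zero suminf_zero)
  then have "\<delta> * (l2_norm ?x)\<^sup>2 \<le> 0"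
    using gap_coercive[OF assms section_vector_ell2, of 0 1 j z] by simp
  then have "(l2_norm ?x)\<^sup>2 \<le> 0" using assms by (simp add: gap_def mult_le_0_iff)
  then have "l2_norm ?x = 0" by simp
  then have "block_last ?x 0 = 0"
    using cmod_le_l2_norm[OF section_vector_ell2, of 0 1 j z] by (simp add: block_last_def)
  then show False
    using \<open>j \<noteq> 0\<close> sign[of 0] by (auto simp: section_vector_def P_def)
qed

abbreviation approximant :: "nat \<Rightarrow> complex \<Rightarrow> complex" where
  "approximant j z \<equiv> - poly (Q j) z / poly (P j) z"

definition section_solution :: "nat \<Rightarrow> complex \<Rightarrow> nat \<Rightarrow> complex" where
  "section_solution j z = section_vector 1 (approximant j z) j z"

lemma section_solution_row:
  assumes "poly (P j) z \<noteq> 0" "R < n j"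
  shows "H (section_solution j z) R - z * section_solution j z R = e_vec R"
  unfolding section_solution_def
  using section_vector_row[of 1 j z "approximant j z" R] assms by simp

lemma galerkin_section_solution:
  assumes "poly (P j) z \<noteq> 0" shows "galerkin z (section_solution j z)"
  using section_solution_row[OF assms] section_vector_support[of j _ 1 "approximant j z" z]
  by (auto simp: galerkin_def section_solution_def section_vector_ell2 not_less[symmetric])

lemma section_solution_rec:
  assumes "i < j" "poly (P j) z \<noteq> 0"
  defines "\<tau> \<equiv> block_last (section_solution j z)"
  shows "coupling \<tau> i - poly (pc i) z * \<tau> i = (if i = 0 then 1 else 0)"
proof -
  let ?u = "\<lambda>i. complex_of_real (\<epsilon> i) * (1 * poly (Q i) z + approximant j z * poly (P i) z)"
  have \<tau>: "\<tau> = (\<lambda>i. if i < j then ?u i else 0)"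
    unfolding \<tau>_def section_solution_def section_vector_def block_last_horner by (rule refl)
  \<comment> \<open>At index \<open>j\<close> the uncut combination vanishes by the choice of
    \<open>approximant\<close>, so the recurrence survives in the last block.\<close>
  have "\<tau> (Suc i) = ?u (Suc i)" using assms(1,2) by (cases "Suc i = j") (auto simp: \<tau>)
  moreover have "\<tau> i = ?u i" "\<tau> (i - 1) = ?u (i - 1)" using assms(1) by (auto simp: \<tau>)
  ultimately have "coupling \<tau> i = coupling ?u i" "\<tau> i = ?u i" unfolding coupling_def by presburger+
  then show ?thesis using recurrence_solution[of 1 z "approximant j z" i] by simp
qed

subsection \<open>The resolvent\<close>

lemma H_row_tendsto:
  assumes "\<And>c. (\<lambda>l. y l c) \<longlonglongrightarrow> x c"
  shows "(\<lambda>l. H (y l) R) \<longlonglongrightarrow> H x R"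
proof -
  obtain i r where R: "R = n i + r" and r: "r < degree (p i)" by (rule block_cases)
  show ?thesis
    unfolding R H_row[OF r] coupling_def block_last_def
    by (cases "r = 0"; cases "i = 0") (auto intro!: tendsto_intros assms)
qed

text \<open>Compactness: a diagonal subsequence of the section solutions converges in every
  coordinate, bounded partial sums keep the limit in \<open>ell2\<close>, and finite rows pass to
  the limit.\<close>

lemma solution_exists:
  assumes gap: "gap \<delta> z"
  obtains x where "x \<in> ell2" "\<And>R. H x R - z * x R = e_vec R"
proof -
  have g: "galerkin z (section_solution j z)" for j
    by (rule galerkin_section_solution[OF P_nonzero[OF gap]])
  then have ell2: "section_solution j z \<in> ell2" for j by (simp add: galerkin_def)
  have bd: "l2_norm (section_solution j z) \<le> 1 / \<delta>" for j by (rule galerkin_bound[OF gap g])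
  have "cmod (section_solution j z R) \<le> 1 / \<delta>" for j R
    using cmod_le_l2_norm[OF ell2] bd order_trans by blast
  then obtain k where k: "strict_mono (k :: nat \<Rightarrow> nat)"
      "\<And>R. \<exists>l. (\<lambda>j. section_solution (k j) z R) \<longlonglongrightarrow> l"
    using function_convergent_subsequence[of UNIV "\<lambda>j R. section_solution j z R" "1 / \<delta>"]
    by (metis UNIV_I countableI_type)
  then obtain x where x: "\<And>R. (\<lambda>j. section_solution (k j) z R) \<longlonglongrightarrow> x R" by metis
  have "(\<Sum>i<m. (cmod (x i))\<^sup>2) \<le> (1 / \<delta>)\<^sup>2" for m
  proof (rule LIMSEQ_le_const2)
    show "(\<lambda>j. \<Sum>i<m. (cmod (section_solution (k j) z i))\<^sup>2) \<longlonglongrightarrow> (\<Sum>i<m. (cmod (x i))\<^sup>2)"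
      by (intro tendsto_intros x)
    have "(\<Sum>i<m. (cmod (section_solution j z i))\<^sup>2) \<le> (1 / \<delta>)\<^sup>2" for j
      using sum_le_l2_norm_sq[OF ell2[of j], of m] power_mono[OF bd[of j] l2_norm_nonneg[OF ell2[of j]], of 2]
      by linarith
    then show "\<exists>N. \<forall>j\<ge>N. (\<Sum>i<m. (cmod (section_solution (k j) z i))\<^sup>2) \<le> (1 / \<delta>)\<^sup>2" by blast
  qed
  then have "x \<in> ell2" by (rule ell2_bounded_sums(1)) (use gap in \<open>simp add: gap_def\<close>)
  moreover have "H x R - z * x R = e_vec R" for R
  proof (rule LIMSEQ_unique)
    show "(\<lambda>j. H (section_solution (k j) z) R - z * section_solution (k j) z R) \<longlonglongrightarrow> H x R - z * x R"
      by (intro tendsto_intros H_row_tendsto x)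
    show "(\<lambda>j. H (section_solution (k j) z) R - z * section_solution (k j) z R) \<longlonglongrightarrow> e_vec R"
    proof (rule tendsto_eventually, rule eventually_sequentiallyI)
      fix j assume "j \<ge> Suc R"
      \<comment> \<open>Row \<open>R\<close> belongs to the section as soon as
        \<open>R < j \<le> k j \<le> n (k j)\<close>.\<close>
      then have "R < k j" using strict_mono_imp_increasing[OF k(1), of j] by linarith
      also have "k j \<le> n (k j)" by (rule strict_mono_imp_increasing[OF block_start_strict_mono])
      finally show "H (section_solution (k j) z) R - z * section_solution (k j) z R = e_vec R"
        by (rule section_solution_row[OF P_nonzero[OF gap]])
    qed
  qed
  ultimately show thesis by (rule that)
qed

lemma resolvent_solution:
  assumes "gap \<delta> z"
  shows "resolvent H z e_vec \<in> ell2"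
    and "H (resolvent H z e_vec) R - z * resolvent H z e_vec R = e_vec R"
proof -
  obtain x where "x \<in> ell2" "\<And>R. H x R - z * x R = e_vec R"
    using solution_exists[OF assms] by blast
  then have *: "e_vec \<in> (\<lambda>x i. H x i - z * x i) ` ell2"
    by (intro image_eqI[of _ _ x]) auto
  show "resolvent H z e_vec \<in> ell2"
    unfolding resolvent_def by (rule inv_into_into[OF *])
  show "H (resolvent H z e_vec) R - z * resolvent H z e_vec R = e_vec R"
    unfolding resolvent_def using fun_cong[OF f_inv_into_f[OF *], of R] by simp
qed

lemma galerkin_resolvent: "gap \<delta> z \<Longrightarrow> galerkin z (resolvent H z e_vec)"
  using resolvent_solution by (simp add: galerkin_def)

text \<open>The resolvent identity \<open>(H - z) d = (z - w) y\<close> together with coercivity;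
  one factor \<open>1 / \<delta>\<close> comes from inverting \<open>H - z\<close>, the other bounds
  \<open>y\<close>.\<close>

lemma resolvent_lipschitz:
  assumes "gap \<delta> z" "gap \<delta> w"
  shows "cmod (resolvent H z e_vec i - resolvent H w e_vec i) \<le> 1 / \<delta>\<^sup>2 * cmod (z - w)"
proof -
  define x where "x = resolvent H z e_vec"
  define y where "y = resolvent H w e_vec"
  define d where "d = (\<lambda>i. x i - y i)"
  have xy: "x \<in> ell2" "y \<in> ell2" "d \<in> ell2"
    using resolvent_solution(1) assms by (auto simp: x_def y_def d_def intro: ell2_diff)
  have \<delta>: "\<delta> > 0" using assms by (simp add: gap_def)
  have "H d i - z * d i = (z - w) * y i" for i
    using resolvent_solution(2)[OF assms(1), of i] resolvent_solution(2)[OF assms(2), of i]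
    unfolding d_def H_diff x_def[symmetric] y_def[symmetric] by (simp add: algebra_simps)
  then have "\<delta> * (l2_norm d)\<^sup>2 \<le> cmod ((z - w) * l2_inner y d)"
    using gap_coercive[OF assms(1) xy(3)] by (simp add: l2_inner_cmult_left xy)
  also have "\<dots> \<le> cmod (z - w) * (l2_norm y * l2_norm d)"
    unfolding norm_mult by (intro mult_left_mono l2_Cauchy_Schwarz xy) simp
  also have "\<dots> \<le> cmod (z - w) * (1 / \<delta> * l2_norm d)"
    using galerkin_bound[OF assms(2) galerkin_resolvent[OF assms(2)]]
    by (intro mult_left_mono mult_right_mono) (auto simp: xy y_def)
  finally have le: "l2_norm d * (\<delta> * l2_norm d) \<le> l2_norm d * (cmod (z - w) / \<delta>)"
    by (simp add: power2_eq_square mult_ac)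
  have "l2_norm d \<le> 1 / \<delta>\<^sup>2 * cmod (z - w)"
  proof (cases "l2_norm d = 0")
    case False
    then have "l2_norm d > 0" using xy by (simp add: less_le)
    with le have "\<delta> * l2_norm d \<le> cmod (z - w) / \<delta>" by (simp only: mult_le_cancel_left_pos)
    then show ?thesis using \<delta> by (simp add: field_simps power2_eq_square)
  qed simp
  then show ?thesis
    using cmod_le_l2_norm[OF xy(3), of i] by (simp add: d_def x_def y_def)
qed

subsection \<open>The error of the approximants\<close>

lemma resolvent_rec:
  assumes "gap \<delta> z"
  defines "t \<equiv> block_last (resolvent H z e_vec)"
  shows "coupling t i - poly (pc i) z * t i = (if i = 0 then 1 else 0)"
proof -
  have e: "e_vec (n i + r) = (if r = 0 then if i = 0 then 1 else 0 else 0)" for r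
    using block_start_less_iff[of 0 i] by (auto simp: e_vec_def)
  have "coupling t i - poly (pc i) z * t i = (\<Sum>r<degree (p i). z ^ r * e_vec (n i + r))"
    unfolding t_def H_row_sum[symmetric] resolvent_solution(2)[OF assms(1)] ..
  also have "\<dots> = (\<Sum>r<degree (p i). if r = 0 then if i = 0 then 1 else 0 else 0)"
    by (intro sum.cong) (simp_all add: e)
  also have "\<dots> = (if i = 0 then 1 else 0)" using deg_pos[of i] by simp
  finally show ?thesis .
qed

text \<open>Both three-term solutions have the same right-hand side, so their Wronskian is constant up to
  the end of the section, where the section solution vanishes.\<close>

lemma approximant_error:
  assumes gap: "gap \<delta> z"
  shows "approximant (Suc j) z - weyl_function \<epsilon> p b z
    = complex_of_real (\<epsilon> (Suc j) * b j) * block_last (section_solution (Suc j) z) j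
      * block_last (resolvent H z e_vec) (Suc j)"
proof -
  define \<tau> where "\<tau> = block_last (section_solution (Suc j) z)"
  define t where "t = block_last (resolvent H z e_vec)"
  \<comment> \<open>With the weight \<open>\<epsilon> (Suc i) * b i\<close>, cross-multiplying the
    two recurrences in row \<open>Suc i\<close> gives \<open>W (Suc i) - W i = 0\<close>.\<close>
  define W where "W i = complex_of_real (\<epsilon> (Suc i)) * complex_of_real (b i) * (\<tau> i * t (Suc i) - t i * \<tau> (Suc i))" for i
  have e: "complex_of_real (\<epsilon> i) * complex_of_real (\<epsilon> i) = 1" for i
    by (metis of_real_1 of_real_mult sign_sq)
  have rec: "coupling \<tau> i - poly (pc i) z * \<tau> i = (if i = 0 then 1 else 0)"
      "coupling t i - poly (pc i) z * t i = (if i = 0 then 1 else 0)" if "i < Suc j" for i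
    unfolding \<tau>_def t_def using section_solution_rec[OF that P_nonzero[OF gap]] resolvent_rec[OF gap] by simp_all
  have W: "W i = complex_of_real (\<epsilon> 0) * (\<tau> 0 - t 0)" if "i < Suc j" for i
    using that
  proof (induction i)
    case 0
    \<comment> \<open>In row \<open>0\<close> both right-hand sides are \<open>1\<close>, which
      leaves \<open>\<tau> 0 - t 0\<close>.\<close>
    have "coupling \<tau> 0 - poly (pc 0) z * \<tau> 0 = 1" "coupling t 0 - poly (pc 0) z * t 0 = 1"
      using rec[of 0] by simp_all
    then have "coupling \<tau> 0 = 1 + poly (pc 0) z * \<tau> 0" "coupling t 0 = 1 + poly (pc 0) z * t 0"
      by (simp_all add: algebra_simps)
    then have "coupling t 0 * \<tau> 0 - coupling \<tau> 0 * t 0 = \<tau> 0 - t 0"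
      by (simp add: algebra_simps)
    moreover have "coupling t 0 * \<tau> 0 - coupling \<tau> 0 * t 0 = complex_of_real (\<epsilon> 0) * W 0"
      by (simp add: coupling_def W_def algebra_simps)
    ultimately have "complex_of_real (\<epsilon> 0) * (\<tau> 0 - t 0)
        = (complex_of_real (\<epsilon> 0) * complex_of_real (\<epsilon> 0)) * W 0"
      by (simp only: mult.assoc)
    then show ?case by (simp only: e mult_1)
  next
    case (Suc i)
    have "coupling \<tau> (Suc i) = poly (pc (Suc i)) z * \<tau> (Suc i)"
        "coupling t (Suc i) = poly (pc (Suc i)) z * t (Suc i)"
      using rec[of "Suc i"] Suc(2) by simp_all
    then have "complex_of_real (\<epsilon> (Suc i)) * (coupling t (Suc i) * \<tau> (Suc i) - coupling \<tau> (Suc i) * t (Suc i)) = 0"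
      by simp
    moreover have "complex_of_real (\<epsilon> (Suc i)) * (coupling t (Suc i) * \<tau> (Suc i) - coupling \<tau> (Suc i) * t (Suc i))
      = (complex_of_real (\<epsilon> (Suc i)) * complex_of_real (\<epsilon> (Suc i))) * W (Suc i) - W i"
      by (simp add: coupling_def W_def algebra_simps)
    ultimately have "W (Suc i) = W i" by (simp add: e)
    then show ?case using Suc by simp
  qed
  have "\<tau> (Suc j) = 0" by (simp add: \<tau>_def section_solution_def section_vector_def)
  then have "W j = complex_of_real (\<epsilon> (Suc j) * b j) * \<tau> j * t (Suc j)"
    by (simp add: W_def)
  \<comment> \<open>\<open>Q 0 = 0\<close> and \<open>P 0 = 1\<close>, so \<open>\<tau> 0\<close> is
    \<open>\<epsilon> 0\<close> times the approximant.\<close>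
  moreover have "complex_of_real (\<epsilon> 0) * \<tau> 0 = approximant (Suc j) z"
  proof -
    have "complex_of_real (\<epsilon> 0) * \<tau> 0
        = (complex_of_real (\<epsilon> 0) * complex_of_real (\<epsilon> 0)) * approximant (Suc j) z"
      by (simp add: \<tau>_def section_solution_def section_vector_def P_def Q_def)
    then show ?thesis by (simp only: e mult_1)
  qed
  ultimately show ?thesis
    using W[of j] by (simp add: weyl_function_eq t_def[symmetric] \<tau>_def[symmetric] right_diff_distrib)
qed

lemma approximant_error_bound:
  assumes "gap \<delta> z"
  shows "cmod (approximant (Suc j) z - weyl_function \<epsilon> p b z)
    \<le> M * cmod (section_solution (Suc j) z (n (Suc j) - 1))
        * cmod (resolvent H z e_vec (n (Suc (Suc j)) - 1))"
  unfolding approximant_error[OF assms] block_last_def norm_mult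
  using b_pos[of j] b_le[of j]
  by (intro mult_right_mono) (auto simp: norm_mult)

subsection \<open>Order of contact at infinity\<close>

text \<open>\<open>H\<close> has a single subdiagonal, so each step down the coordinates gains a factor \<open>K / |z|\<close>.\<close>

lemma galerkin_decay:
  assumes gap: "gap \<delta> z" and x: "galerkin z x" and "z \<noteq> 0" and "i \<le> c"
  shows "cmod (x c) \<le> 1 / \<delta> * (K / cmod z) ^ i"
  using \<open>i \<le> c\<close>
proof (induction i arbitrary: c)
  case 0
  then show ?case
    using cmod_le_l2_norm[of x c] x galerkin_bound[OF gap x] by (simp add: galerkin_def)
next
  case (Suc i)
  let ?S = "1 / \<delta> * (K / cmod z) ^ i"
  have S: "?S \<ge> 0" using gap K_pos by (simp add: gap_def)
  have step: "1 / \<delta> * (K / cmod z) ^ Suc i = K * ?S / cmod z" by simp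
  show ?case
  proof (cases "x c = 0")
    case True
    have "K * ?S / cmod z \<ge> 0"
      by (rule divide_nonneg_nonneg[OF mult_nonneg_nonneg[OF less_imp_le[OF K_pos] S] norm_ge_zero])
    then show ?thesis unfolding step using True by simp
  next
    case False
    then have "H x c = z * x c" using x Suc(2) by (force simp: galerkin_def e_vec_def)
    \<comment> \<open>The window begins at \<open>c - 1\<close>, which is still at least
      \<open>i\<close>, so the induction hypothesis applies on all of it.\<close>
    moreover have "cmod (H x c) \<le> K * ?S"
      unfolding K_def by (rule H_local_bound, fold K_def) (use Suc in auto)
    ultimately have "cmod (x c) * cmod z \<le> K * ?S" by (simp only: norm_mult mult.commute)
    then show ?thesis unfolding step using \<open>z \<noteq> 0\<close> by (intro mult_imp_le_div_pos) simp_all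
  qed
qed

lemma H_norm_bound_nonneg: "H_norm_bound \<ge> 0"
  using K_pos by (simp add: H_norm_bound_def)

text \<open>Here the gap grows with \<open>z\<close>: the numerical range lies in a disc of radius
  at most half of \<open>cmod z\<close>. The bounds \<open>1 / \<delta>\<close> then supply extra
  powers of \<open>1 / z\<close>.\<close>

lemma gap_at_infinity:
  assumes "cmod z \<ge> 2 * H_norm_bound + 1"
  shows "gap (cmod z / 2) z"
proof -
  have "cmod z / 2 \<le> dist w z" if "w \<in> numerical_range H" for w
    using numerical_range_bounded[OF that] norm_triangle_ineq2[of z w] assms
    by (simp add: dist_norm norm_minus_commute)
  then show ?thesis using assms H_norm_bound_nonneg by (auto simp: gap_def)
qed

text \<open>Counting powers with \<open>m = n (Suc j)\<close>: the section solution at index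
  \<open>m - 1\<close> and the resolvent at an index at least \<open>m\<close> decay with exponents
  \<open>m - 1\<close> and \<open>m\<close>, and each factor
  \<open>1 / \<delta> = 2 / cmod z\<close> adds one, in total \<open>2 * m + 1\<close>. The same
  factors give the constant \<open>4\<close>.\<close>

lemma approximant_order:
  assumes z: "cmod z \<ge> 2 * H_norm_bound + 1"
  shows "cmod (approximant (Suc j) z - weyl_function \<epsilon> p b z)
    \<le> (4 * M * K ^ (2 * n (Suc j) - 1)) * cmod (1 / z ^ (2 * n (Suc j) + 1))"
proof -
  define m where "m = n (Suc j)"
  obtain l where l: "m = Suc l"
    using deg_pos[of j] not0_implies_Suc[of m] by (auto simp: m_def)
  have g: "gap (cmod z / 2) z" by (rule gap_at_infinity[OF z])
  have z0: "z \<noteq> 0" "cmod z > 0" using g by (auto simp: gap_def)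
  have "cmod (section_solution (Suc j) z (m - 1)) \<le> 1 / (cmod z / 2) * (K / cmod z) ^ l"
    by (rule galerkin_decay[OF g galerkin_section_solution[OF P_nonzero[OF g]] z0(1)]) (simp add: l)
  moreover have "cmod (resolvent H z e_vec (n (Suc (Suc j)) - 1)) \<le> 1 / (cmod z / 2) * (K / cmod z) ^ m"
    by (rule galerkin_decay[OF g galerkin_resolvent[OF g] z0(1)])
      (use deg_pos[of "Suc j"] in \<open>simp add: m_def\<close>)
  ultimately have "M * cmod (section_solution (Suc j) z (m - 1)) * cmod (resolvent H z e_vec (n (Suc (Suc j)) - 1))
      \<le> M * (1 / (cmod z / 2) * (K / cmod z) ^ l) * (1 / (cmod z / 2) * (K / cmod z) ^ m)"
    using M_pos K_pos by (intro mult_mono) auto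
  also have "\<dots> = 4 * M * (K ^ l * K ^ m) / (cmod z ^ l * cmod z ^ m * cmod z ^ 2)"
    by (simp add: power_divide field_simps power2_eq_square)
  also have "\<dots> = (4 * M * K ^ (2 * m - 1)) * cmod (1 / z ^ (2 * m + 1))"
    by (simp add: l power_add[symmetric] norm_divide norm_power norm_mult mult_2 mult_2_right power2_eq_square mult_ac)
  finally show ?thesis
    using approximant_error_bound[OF g, of j] unfolding m_def by linarith
qed

text \<open>This is \<open>- Q j\<close> divided by \<open>z ^ n j\<close>, as a polynomial in
  \<open>1 / z\<close>; the monomial compensates for a degree of \<open>Q j\<close> below
  \<open>n j\<close>.\<close>

definition pade_num :: "nat \<Rightarrow> complex poly" where
  "pade_num j = monom 1 (n j - degree (Q j)) * reflect_poly (- Q j)"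

definition pade_fun :: "nat \<Rightarrow> complex \<Rightarrow> complex" where
  "pade_fun j = remove_sings (\<lambda>z. poly (pade_num j) (1 / z) / poly (reflect_poly (P j)) (1 / z))"

lemma pade_quotient:
  assumes "z \<noteq> 0"
  shows "poly (pade_num j) (1 / z) / poly (reflect_poly (P j)) (1 / z) = approximant j z"
proof -
  have "poly (pade_num j) (1 / z) = (1 / z) ^ (n j - degree (Q j)) * ((1 / z) ^ degree (Q j) * - poly (Q j) z)"
    using assms by (simp add: pade_num_def poly_monom poly_reflect_poly_nz)
  also have "\<dots> = (1 / z) ^ n j * - poly (Q j) z"
    using degree_Q[of j] by (simp only: mult.assoc[symmetric] power_add[symmetric]) simp
  finally have "poly (pade_num j) (1 / z) = (1 / z) ^ n j * - poly (Q j) z" .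
  moreover have "poly (reflect_poly (P j)) (1 / z) = (1 / z) ^ n j * poly (P j) z"
    using assms degree_P[of j] by (simp add: poly_reflect_poly_nz)
  ultimately show ?thesis using assms by simp
qed

text \<open>Includes \<open>z = 0\<close>, where the quotient in \<open>1 / z\<close> has no
  meaningful value: \<open>pade_quotient\<close> holds in a punctured neighbourhood and
  \<open>remove_sings\<close> takes the limit.\<close>

lemma pade_fun_eq:
  assumes "poly (P j) z \<noteq> 0" shows "pade_fun j z = approximant j z"
  unfolding pade_fun_def
proof (rule remove_sings_eqI)
  have "(approximant j \<longlongrightarrow> approximant j z) (at z)"
    by (intro tendsto_intros assms)
  moreover have "eventually (\<lambda>w. w \<noteq> 0) (at z)"
    by (rule eventually_neq_at_within)
  then have "eventually (\<lambda>w. approximant j w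
      = poly (pade_num j) (1 / w) / poly (reflect_poly (P j)) (1 / w)) (at z)"
    by eventually_elim (rule pade_quotient[symmetric])
  ultimately show "((\<lambda>w. poly (pade_num j) (1 / w) / poly (reflect_poly (P j)) (1 / w))
      \<longlongrightarrow> approximant j z) (at z)"
    by (rule Lim_transform_eventually)
qed

lemma is_diag_pade_pade_fun:
  "is_diag_pade (weyl_function \<epsilon> p b) (n (Suc j)) (pade_fun (Suc j))"
  unfolding is_diag_pade_def
proof (intro exI conjI)
  let ?j = "Suc j"
  show "degree (pade_num ?j) \<le> n ?j"
    using degree_mult_le[of "monom 1 (n ?j - degree (Q ?j))" "reflect_poly (- Q ?j)"]
      degree_monom_le[of "1::complex" "n ?j - degree (Q ?j)"]
      degree_reflect_poly_le[of "- Q ?j"] degree_Q[of ?j]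
    unfolding pade_num_def degree_minus by linarith
  show "degree (reflect_poly (P ?j)) \<le> n ?j"
    using degree_reflect_poly_le[of "P ?j"] degree_P[of ?j] by simp
  show "poly (reflect_poly (P ?j)) 0 \<noteq> 0"
    unfolding reflect_poly_at_0_eq_0_iff using degree_P by blast
  show "pade_fun ?j = remove_sings (\<lambda>z. poly (pade_num ?j) (1 / z) / poly (reflect_poly (P ?j)) (1 / z))"
    by (simp add: pade_fun_def)
  have "eventually (\<lambda>z. cmod z \<ge> 2 * H_norm_bound + 1) at_infinity"
    by (auto simp: eventually_at_infinity)
  then have "eventually (\<lambda>z. cmod (pade_fun ?j z - weyl_function \<epsilon> p b z)
      \<le> (4 * M * K ^ (2 * n ?j - 1)) * cmod (1 / z ^ (2 * n ?j + 1))) at_infinity"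
  proof eventually_elim
    case (elim z)
    show ?case
      unfolding pade_fun_eq[OF P_nonzero[OF gap_at_infinity[OF elim]]] by (rule approximant_order[OF elim])
  qed
  then show "(\<lambda>z. pade_fun ?j z - weyl_function \<epsilon> p b z) \<in> O[at_infinity](\<lambda>z. 1 / z ^ (2 * n ?j + 1))"
    by (rule bigoI)
qed

lemma diag_pade_eq_approximant:
  assumes "gap \<delta> z"
  shows "diag_pade (weyl_function \<epsilon> p b) (n (Suc j)) z = approximant (Suc j) z"
  unfolding diag_pade_eqI[OF is_diag_pade_pade_fun] by (rule pade_fun_eq[OF P_nonzero[OF assms]])

subsection \<open>Convergence\<close>

text \<open>Halving the radius of a ball that avoids the closure lets one number be both the radius
  and the gap.\<close>

lemma locally_uniform_gap:
  assumes "z \<in> - closure (numerical_range H)"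
  obtains \<delta> where "\<delta> > 0" "\<And>w. w \<in> cball z \<delta> \<Longrightarrow> gap \<delta> w"
proof -
  obtain e where e: "e > 0" "ball z e \<subseteq> - closure (numerical_range H)"
    using assms open_contains_ball[of "- closure (numerical_range H)"] by blast
  have "gap (e / 2) w" if w: "w \<in> cball z (e / 2)" for w
    unfolding gap_def
  proof (intro conjI ballI)
    fix v assume "v \<in> numerical_range H"
    then have "v \<notin> ball z e" using e(2) closure_subset by blast
    then show "e / 2 \<le> dist v w" using w dist_triangle[of z v w] by (simp add: dist_commute)
  qed (use e in simp)
  then show thesis using that[of "e / 2"] e by simp
qed

text \<open>The error is at most \<open>M / \<delta>\<close> times a coordinate of the resolvent
  vector whose index grows; these coordinates tend to \<open>0\<close> pointwise since the vector is
  in \<open>ell2\<close>, and uniformly by \<open>resolvent_lipschitz\<close>.\<close>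

lemma diag_pade_locally_uniform:
  "locally_uniform_limit (UNIV - closure (numerical_range H))
    (\<lambda>l. diag_pade (weyl_function \<epsilon> p b) (n (Suc l))) (weyl_function \<epsilon> p b)"
  unfolding locally_uniform_limit_def
proof
  fix z assume "z \<in> UNIV - closure (numerical_range H)"
  then obtain \<delta> where \<delta>: "\<delta> > 0" "\<And>w. w \<in> cball z \<delta> \<Longrightarrow> gap \<delta> w"
    using locally_uniform_gap[of z] by auto
  define g where "g l w = resolvent H w e_vec (n (Suc (Suc l)) - 1)" for l w
  have g: "uniform_limit (cball z \<delta>) g (\<lambda>_. 0) sequentially"
  proof (rule uniform_limit_equi_lipschitz)
    fix l v w assume "v \<in> cball z \<delta>" "w \<in> cball z \<delta>"
    then show "dist (g l v) (g l w) \<le> 1 / \<delta>\<^sup>2 * dist v w"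
      unfolding g_def dist_norm by (intro resolvent_lipschitz \<delta>)
  next
    fix w assume "w \<in> cball z \<delta>"
    then have "resolvent H w e_vec \<longlonglongrightarrow> 0"
      by (intro ell2_tendsto_0 resolvent_solution(1)[OF \<delta>(2)])
    moreover have "strict_mono (\<lambda>l. n (Suc (Suc l)) - 1)"
      using deg_pos by (intro strict_mono_Suc_iff[THEN iffD2] allI) (simp add: less_diff_conv)
    ultimately show "(\<lambda>l. g l w) \<longlonglongrightarrow> 0"
      unfolding g_def using LIMSEQ_subseq_LIMSEQ[of "resolvent H w e_vec" 0] by (simp add: o_def)
  qed simp
  have "uniform_limit (cball z \<delta>) (\<lambda>l. diag_pade (weyl_function \<epsilon> p b) (n (Suc l)))
      (weyl_function \<epsilon> p b) sequentially"
  proof (rule uniform_limitI)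
    fix e :: real assume "e > 0"
    \<comment> \<open>Chosen so that \<open>M * (1 / \<delta>) * e' = e\<close>.\<close>
    define e' where "e' = e * \<delta> / M"
    have e': "e' > 0" using \<open>e > 0\<close> \<delta> M_pos by (simp add: e'_def)
    from uniform_limitD[OF g e']
    show "eventually (\<lambda>l. \<forall>w\<in>cball z \<delta>. dist (diag_pade (weyl_function \<epsilon> p b) (n (Suc l)) w)
        (weyl_function \<epsilon> p b w) < e) sequentially"
    proof eventually_elim
      case (elim l)
      show ?case
      proof
        fix w assume w: "w \<in> cball z \<delta>"
        note gap = \<delta>(2)[OF w]
        have gs: "galerkin w (section_solution (Suc l) w)"
          by (rule galerkin_section_solution[OF P_nonzero[OF gap]])
        have "cmod (section_solution (Suc l) w (n (Suc l) - 1)) \<le> 1 / \<delta>"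
          using cmod_le_l2_norm galerkin_bound[OF gap gs] gs order_trans
          unfolding galerkin_def by blast
        then have "M * cmod (section_solution (Suc l) w (n (Suc l) - 1)) * cmod (g l w)
            \<le> M * (1 / \<delta>) * cmod (g l w)"
          using M_pos by (intro mult_right_mono mult_left_mono) auto
        also have "\<dots> < M * (1 / \<delta>) * e'"
          using elim w M_pos \<delta>(1) by (intro mult_strict_left_mono) auto
        also have "\<dots> = e" using M_pos \<delta>(1) by (simp add: e'_def)
        finally show "dist (diag_pade (weyl_function \<epsilon> p b) (n (Suc l)) w) (weyl_function \<epsilon> p b w) < e"
          using approximant_error_bound[OF gap, of l]
          unfolding diag_pade_eq_approximant[OF gap] dist_norm g_def by linarith
      qed
    qed
  qed
  then show "\<exists>r>0. uniform_limit (ball z r \<inter> (UNIV - closure (numerical_range H)))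
      (\<lambda>l. diag_pade (weyl_function \<epsilon> p b) (n (Suc l))) (weyl_function \<epsilon> p b) sequentially"
    using \<delta>(1) by (intro exI[of _ \<delta>] conjI) (auto elim: uniform_limit_on_subset)
qed

end

theorem theorem7p3:
  fixes \<epsilon> b :: "nat \<Rightarrow> real" and p :: "nat \<Rightarrow> real poly"
  assumes "\<And>j. lead_coeff (p j) = 1"
    and "\<And>j. degree (p j) \<ge> 1"
    and "\<And>j. \<epsilon> j \<in> {1, -1}"
    and "\<And>j. b j > 0"
    and "\<exists>N::nat. \<forall>j. degree (p j) \<le> N"
    and "bdd_above ({b j | j. True} \<union> {\<bar>poly.coeff (p j) k\<bar> | j k. k < degree (p j)})"
  shows "\<exists>\<sigma> :: nat \<Rightarrow> nat. strict_mono \<sigma> \<and> (\<forall>l. \<sigma> l \<ge> 1) \<and>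
    locally_uniform_limit (UNIV - closure (numerical_range (gen_jacobi_op \<epsilon> p b)))
      (\<lambda>l. diag_pade (weyl_function \<epsilon> p b) (block_start (\<lambda>j. degree (p j)) (\<sigma> l)))
      (weyl_function \<epsilon> p b)"
proof -
  obtain N where N: "\<And>j. degree (p j) \<le> N" using assms(5) by blast
  obtain M where M: "\<And>v. v \<in> {b j | j. True} \<union> {\<bar>poly.coeff (p j) k\<bar> | j k. k < degree (p j)} \<Longrightarrow> v \<le> M"
    using assms(6) unfolding bdd_above_def by blast
  interpret gen_jacobi \<epsilon> b p M N
  proof
    show "degree (p j) > 0" for j using assms(2)[of j] by simp
    show "b j \<le> M" for j by (rule M) auto
    show "\<bar>poly.coeff (p j) i\<bar> \<le> M" if "i < degree (p j)" for i j by (rule M) (use that in auto)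
  qed (rule assms N)+
  \<comment> \<open>\<open>\<sigma> = Suc\<close> lists all indices from \<open>1\<close> on: the
    whole sequence converges.\<close>
  have "strict_mono Suc" by (simp add: strict_mono_Suc_iff)
  then show ?thesis
    using diag_pade_locally_uniform by (intro exI[of _ Suc]) auto
qed

end
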